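(* Let $s\ge1$ and let $0=c_0<c_1<\cdots<c_s=1$. Let $a_{ij},\widehat a_{ij}$ ($1\le i\le s$, $0\le j\le s$) be the unique real coefficients satisfying, for $i=1,\ldots,s$, the polynomial identity $$\frac{\Pi_i(z)-Q_s(z)}{z}=\sum_{j=0}^s a_{ij}\Pi_j(z)+z\sum_{j=0}^s\widehat a_{ij}\Pi_j(z),$$ and consider the anchored method $$Y_i=Y_0+\Delta t\sum_{j=0}^s a_{ij}\mathcal L(Y_j)+\Delta t^2\sum_{j=0}^s\widehat a_{ij}\dot{\mathcal L}(Y_j),\quad i=1,\ldots,s,\qquad Y_0=u^n,\quad u^{n+1}=Y_s.$$ Then the method satisfies all $2s$ moment conditions $$\sum_{j=0}^s a_{ij}c_j^{m-1}+(m-1)\sum_{j=0}^s\widehat a_{ij}c_j^{m-2}=\frac{c_i^m}{m},\qquad m=1,\ldots,2s,\quad i=1,\ldots,s$$ (for $m=1$ the second sum is zero). For the Dahlquist equation $u_t=\lambda u$, with $z=\lambda\Delta t$, every active stage has the exact transfer function $$G_j(z):=\frac{Y_j}{u^n}=\frac{\Pi_j(z)}{Q_s(z)},\qquad j=1,\ldots,s,$$ and the endpoint stability function is $$R_s(z)=G_s(z)=\frac{P_s(z)}{Q_s(z)}=[s-1/s+1]_{e^z}.$$ Moreover, $$\det\left(I-zA-z^2\widehat A\right)=Q_s(z),$$ so the stage system has no poles other than the zeros of $Q_s$ (that is, $I-zA-z^2\widehat A$ is invertible whenever $Q_s(z)\ne0$). The accepted one-step map $u^n\mapsto u^{n+1}$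 is $L$-stable (and therefore $A$-stable) for every positive integer $s$.
   Context: Padé approximant: $[p/q]_{e^z}$ denotes the rational function $P_{p,q}(z)/Q_{p,q}(z)$ with $\deg P_{p,q}\le p$, $\deg Q_{p,q}\le q$, $Q_{p,q}(0)=1$ and $Q_{p,q}(z)e^z-P_{p,q}(z)=\mathcal O(z^{p+q+1})$ as $z\to0$. For $p=s-1$, $q=s+1$, numerator and denominator are denoted $P_s,Q_s$; explicitly $$P_s(z)=\sum_{k=0}^{s-1}\frac{(2s-k)!\,(s-1)!}{(2s)!\,k!\,(s-1-k)!}z^k,\qquad Q_s(z)=\sum_{k=0}^{s+1}\frac{(2s-k)!\,(s+1)!}{(2s)!\,k!\,(s+1-k)!}(-z)^k.$$ Stage polynomials: for $j=0,\ldots,s$, $\Pi_j(z)$ is the Taylor truncation at degree $2s$ (terms of degree $\le 2s$ retained) of $Q_s(z)e^{c_jz}$. Thus $\Pi_0=Q_s$ and $\Pi_s=P_s$. The $2s+2$ polynomials $\Pi_0,\ldots,\Pi_s,z\Pi_0,\ldots,z\Pi_s$ form a basis of the space of real polynomials of degree at most $2s+1$, and $(\Pi_i-Q_s)/z$ is a polynomial of degree at most $2s-1$, so the coefficients $a_{ij},\widehat a_{ij}$ exist and are unique. Matrices: $A=(a_{ij})_{i,j=1}^s$, $\widehat A=(\widehat a_{ij})_{i,j=1}^s$, and $I$ is the $s\times s$ identity; the anchor columns are $a_0=(a_{10},\ldots,a_{s0})^T$, $\widehat a_0=(\widehat a_{10},\ldots,\widehat a_{s0})^T$. Method and linear test equation: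 the method is applied to $u_t=\mathcal L(u)$, with $\dot{\mathcal L}(u)=\mathcal L_u(u)\mathcal L(u)$. For $u_t=\lambda u$, $\lambda\in\mathbb C$, one has $\mathcal L(u)=\lambda u$, $\dot{\mathcal L}(u)=\lambda^2u$, and with $Y=(Y_1,\ldots,Y_s)^T$ the stage system is $(I-zA-z^2\widehat A)Y=(\mathbf 1+za_0+z^2\widehat a_0)u^n$, where $\mathbf 1=(1,\ldots,1)^T$. The stability function is $R_s(z)=e_s^T(I-zA-z^2\widehat A)^{-1}(\mathbf 1+za_0+z^2\widehat a_0)$, with $e_s$ the last standard basis vector, i.e. $R_s(z)=Y_s/u^n=u^{n+1}/u^n$. Stability: a one-step map with stability function $R$ is $A$-stable if $R$ is analytic in, and $|R(z)|\le1$ on, the closed half-plane $\operatorname{Re}z\le0$; it is $L$-stable if it is $A$-stable and $R(z)\to0$ as $|z|\to\infty$ in the left half-plane. The convention $0^0=1$ is used for powers of $c_0=0$. *)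

theory Defs
  imports
    "HOL-Analysis.Analysis"
    "HOL-Library.Landau_Symbols"
    "HOL-Computational_Algebra.Computational_Algebra"
    "Jordan_Normal_Form.Gauss_Jordan_Elimination"
    "Jordan_Normal_Form.Determinant"
begin

abbreviation cpoly :: "real poly \<Rightarrow> complex \<Rightarrow> complex" where
  "cpoly p z \<equiv> poly (map_poly of_real p) z"


text \<open>Pade approximants of the exponential function. The pair \<open>(P, Q)\<close> is unique, because the
  Pade table of the exponential function is normal.\<close>

definition is_pade_exp :: "nat \<Rightarrow> nat \<Rightarrow> complex poly \<Rightarrow> complex poly \<Rightarrow> bool" where
  "is_pade_exp p q P Q \<longleftrightarrow> degree P \<le> p \<and> degree Q \<le> q \<and> poly Q 0 = 1 \<and>
     (\<lambda>z. poly Q z * exp z - poly P z) \<in> O[at 0](\<lambda>z. z ^ (p + q + 1))"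

definition pade_exp :: "nat \<Rightarrow> nat \<Rightarrow> complex \<Rightarrow> complex" where
  "pade_exp p q z = (case (THE (P, Q). is_pade_exp p q P Q) of (P, Q) \<Rightarrow> poly P z / poly Q z)"

definition pade_num :: "nat \<Rightarrow> real poly" where
  "pade_num s = (\<Sum>k\<le>s - 1.
     monom (fact (2 * s - k) * fact (s - 1) / (fact (2 * s) * fact k * fact (s - 1 - k))) k)"

definition pade_den :: "nat \<Rightarrow> real poly" where
  "pade_den s = (\<Sum>k\<le>s + 1.
     monom ((-1) ^ k * (fact (2 * s - k) * fact (s + 1) / (fact (2 * s) * fact k * fact (s + 1 - k)))) k)"


text \<open>\<open>stage_poly s x\<close> is the truncation of \<open>Q\<^sub>s(z) exp(x z)\<close>, with all terms of degree
  at most \<open>2 s\<close> kept; the polynomial \<open>\<Pi>\<^sub>j\<close> is \<open>stage_poly s (c j)\<close>.\<close>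

definition stage_poly :: "nat \<Rightarrow> real \<Rightarrow> real poly" where
  "stage_poly s x = truncate_fps (2 * s + 1) (fps_of_poly (pade_den s) * fps_exp x)"

text \<open>The division by \<open>[:0, 1:]\<close>, i.e. by \<open>z\<close>, is exact: both polynomials have constant
  coefficient 1. Only the entries \<open>a i j\<close>, \<open>ah i j\<close> with \<open>1 \<le> i \<le> s\<close>, \<open>j \<le> s\<close> are relevant.\<close>

definition method_coeffs ::
  "nat \<Rightarrow> (nat \<Rightarrow> real) \<Rightarrow> (nat \<Rightarrow> nat \<Rightarrow> real) \<Rightarrow> (nat \<Rightarrow> nat \<Rightarrow> real) \<Rightarrow> bool" where
  "method_coeffs s c a ah \<longleftrightarrow> (\<forall>i\<in>{1..s}.
     (stage_poly s (c i) - pade_den s) div [:0, 1:] =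
       (\<Sum>j\<le>s. Polynomial.smult (a i j) (stage_poly s (c j)))
       + [:0, 1:] * (\<Sum>j\<le>s. Polynomial.smult (ah i j) (stage_poly s (c j))))"


text \<open>The anchored two-derivative method with step size \<open>h\<close> for \<open>u\<^sub>t = L(u)\<close>.\<close>

definition second_deriv :: "('a \<Rightarrow> 'a) \<Rightarrow> 'a::real_normed_vector \<Rightarrow> 'a" where
  "second_deriv L u = frechet_derivative L (at u) (L u)"

definition anchored_stages ::
  "nat \<Rightarrow> (nat \<Rightarrow> nat \<Rightarrow> real) \<Rightarrow> (nat \<Rightarrow> nat \<Rightarrow> real) \<Rightarrow> real \<Rightarrow>
   ('a::real_normed_vector \<Rightarrow> 'a) \<Rightarrow> 'a \<Rightarrow> (nat \<Rightarrow> 'a) \<Rightarrow> bool" where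
  "anchored_stages s a ah h L u Y \<longleftrightarrow> Y 0 = u \<and> (\<forall>i\<in>{1..s}.
     Y i = Y 0 + h *\<^sub>R (\<Sum>j\<le>s. a i j *\<^sub>R L (Y j))
               + h\<^sup>2 *\<^sub>R (\<Sum>j\<le>s. ah i j *\<^sub>R second_deriv L (Y j)))"

definition anchored_step ::
  "nat \<Rightarrow> (nat \<Rightarrow> nat \<Rightarrow> real) \<Rightarrow> (nat \<Rightarrow> nat \<Rightarrow> real) \<Rightarrow> real \<Rightarrow>
   ('a::real_normed_vector \<Rightarrow> 'a) \<Rightarrow> 'a \<Rightarrow> 'a \<Rightarrow> bool" where
  "anchored_step s a ah h L u u' \<longleftrightarrow> (\<exists>Y. anchored_stages s a ah h L u Y \<and> u' = Y s)"


text \<open>Matrix rows and columns are numbered from 0, so that entry \<open>(i, j)\<close> of the matrices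
  below is \<open>a (i + 1) (j + 1)\<close> or \<open>ah (i + 1) (j + 1)\<close>.\<close>

definition coeff_mat :: "nat \<Rightarrow> (nat \<Rightarrow> nat \<Rightarrow> real) \<Rightarrow> complex mat" where
  "coeff_mat s a = Matrix.mat s s (\<lambda>(i, j). of_real (a (i + 1) (j + 1)))"

definition anchor_vec :: "nat \<Rightarrow> (nat \<Rightarrow> nat \<Rightarrow> real) \<Rightarrow> complex Matrix.vec" where
  "anchor_vec s a = Matrix.vec s (\<lambda>i. of_real (a (i + 1) 0))"

definition stage_mat ::
  "nat \<Rightarrow> (nat \<Rightarrow> nat \<Rightarrow> real) \<Rightarrow> (nat \<Rightarrow> nat \<Rightarrow> real) \<Rightarrow> complex \<Rightarrow> complex mat" where
  "stage_mat s a ah z = 1\<^sub>m s - z \<cdot>\<^sub>m coeff_mat s a - z\<^sup>2 \<cdot>\<^sub>m coeff_mat s ah"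

definition stage_rhs ::
  "nat \<Rightarrow> (nat \<Rightarrow> nat \<Rightarrow> real) \<Rightarrow> (nat \<Rightarrow> nat \<Rightarrow> real) \<Rightarrow> complex \<Rightarrow> complex Matrix.vec" where
  "stage_rhs s a ah z =
     Matrix.vec s (\<lambda>_. 1) + z \<cdot>\<^sub>v anchor_vec s a + z\<^sup>2 \<cdot>\<^sub>v anchor_vec s ah"

text \<open>Meaningful only where \<open>stage_mat s a ah z\<close> is invertible; elsewhere the value is
  unspecified.\<close>

definition stability_fun ::
  "nat \<Rightarrow> (nat \<Rightarrow> nat \<Rightarrow> real) \<Rightarrow> (nat \<Rightarrow> nat \<Rightarrow> real) \<Rightarrow> complex \<Rightarrow> complex" where
  "stability_fun s a ah z =
     scalar_prod (unit_vec s (s - 1)) (the (mat_inverse (stage_mat s a ah z)) *\<^sub>v stage_rhs s a ah z)"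

definition A_stable :: "(complex \<Rightarrow> complex) \<Rightarrow> bool" where
  "A_stable R \<longleftrightarrow> R analytic_on {z. Re z \<le> 0} \<and> (\<forall>z. Re z \<le> 0 \<longrightarrow> norm (R z) \<le> 1)"

definition L_stable :: "(complex \<Rightarrow> complex) \<Rightarrow> bool" where
  "L_stable R \<longleftrightarrow> A_stable R \<and> (R \<longlongrightarrow> 0) (inf at_infinity (principal {z. Re z \<le> 0}))"

end

theory Submission
  imports
    Defs
    "HOL-Complex_Analysis.Conformal_Mappings"
begin

text \<open>A relation \<open>\<Sum> (\<alpha>\<^sub>j + z \<beta>\<^sub>j) \<Pi>\<^sub>j = 0\<close> says, after division by \<open>Q\<^sub>s\<close> as power series, that the functional
  \<open>p \<mapsto> \<Sum> \<alpha>\<^sub>j p(c\<^sub>j) + \<beta>\<^sub>j p'(c\<^sub>j)\<close> kills all polynomials of degree at most \<open>2 s\<close>; hence it is a multiple of the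
  divided difference on the doubled nodes and all \<open>\<beta>\<^sub>j\<close> have the same sign. The coefficient of degree \<open>2 s + 1\<close> is
  \<open>\<Sum> \<beta>\<^sub>j c\<^sub>j\<^bsup>s-1\<^esup> (c\<^sub>j - 1)\<^bsup>s+1\<^esup> / (2 s)!\<close>, in which all terms have the same sign, so all the weights vanish.
  This gives existence and uniqueness of the coefficients; the moment conditions are read off the same division.

  By Cramer's rule, and because \<open>P\<^sub>s\<close> and \<open>Q\<^sub>s\<close> have no common zeros, the determinant is \<open>g Q\<^sub>s\<close> for a polynomial
  \<open>g\<close>. At a zero of \<open>g\<close> all stage equations would be dependent, and dividing out that zero contradicts the
  independence above.

  For \<open>L\<close>-stability, \<open>Q\<^sub>s\<close> and \<open>P\<^sub>s\<close> are expressed by two consecutive reverse Bessel polynomials. Their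
  ratio has positive real part by the three-term recurrence, which yields the location of the poles and
  \<open>|P\<^sub>s| \<le> |Q\<^sub>s|\<close> on the imaginary axis; the maximum principle does the rest.\<close>

section \<open>Reverse Bessel polynomials\<close>

text \<open>Up to the factor \<open>fact (p + q)\<close> this is the numerator of the [q/p] Pade
  approximant of the exponential. For p = q it is 2^q q! times the reverse Bessel polynomial of
  degree q at x/2.\<close>

definition bess :: "nat \<Rightarrow> nat \<Rightarrow> complex poly" where
  "bess p q = (\<Sum>k\<le>q. monom (of_nat (q choose k) * fact (p + q - k)) k)"

lemma coeff_bess: "coeff (bess p q) k = of_nat (q choose k) * fact (p + q - k)"
  by (simp add: bess_def coeff_sum if_distrib cong: if_cong)

text \<open>Pascal's rule on each coefficient; with the next lemma it links neighbours in the table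
  of all \<open>bess p q\<close>.\<close>

lemma bess_Suc_right: "bess p (Suc q) = bess (Suc p) q + pCons 0 (bess p q)"
proof (rule poly_eqI)
  fix k
  show "coeff (bess p (Suc q)) k = coeff (bess (Suc p) q + pCons 0 (bess p q)) k"
    by (cases k) (simp_all add: coeff_bess algebra_simps)
qed

text \<open>The leading factor of the factorial splits as (p + 1) + (q + 1 - k), and the second part
  is absorbed into the binomial coefficient.\<close>

lemma bess_Suc_Suc:
  "bess (Suc p) (Suc q) = Polynomial.smult (of_nat (Suc p)) (bess p (Suc q)) + Polynomial.smult (of_nat (Suc q)) (bess (Suc p) q)"
proof (rule poly_eqI)
  fix k
  show "coeff (bess (Suc p) (Suc q)) k =
    coeff (Polynomial.smult (of_nat (Suc p)) (bess p (Suc q)) + Polynomial.smult (of_nat (Suc q)) (bess (Suc p) q)) k"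
  proof (cases "k \<le> Suc q")
    case True
    have "Suc q * (q choose k) = (Suc q - k) * (Suc q choose k)"
      using binomial_absorb_comp[of "Suc q" k] by simp
    then have *: "of_nat (Suc q) * of_nat (q choose k) = (of_nat (Suc q - k) * of_nat (Suc q choose k) :: complex)"
      by (metis of_nat_mult)
    have "Suc p + Suc q - k = Suc (Suc p + q - k)" using True by simp
    then have "fact (Suc p + Suc q - k) = of_nat (Suc p + (Suc q - k)) * (fact (Suc p + q - k) :: complex)"
      using True by (simp only: fact_Suc) simp
    then have "coeff (bess (Suc p) (Suc q)) k =
       (of_nat (Suc p) * of_nat (Suc q choose k) + of_nat (Suc q - k) * of_nat (Suc q choose k)) * fact (Suc p + q - k)"
      by (simp only: coeff_bess of_nat_add) (simp only: algebra_simps)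
    then show ?thesis unfolding *[symmetric]
      by (simp add: coeff_bess algebra_simps)
  qed (simp add: coeff_bess binomial_eq_0)
qed

definition bessd :: "nat \<Rightarrow> complex \<Rightarrow> complex" where
  "bessd s x = poly (bess s s) x"

lemma bessd_0: "bessd 0 x = 1"
  by (simp add: bessd_def bess_def)

lemma bessd_1: "bessd (Suc 0) x = 2 + x"
  by (simp add: bessd_def bess_def poly_monom)

text \<open>The two relations above at p = q = m are linear equations for the off-diagonal
  neighbours; solving them leaves only diagonal polynomials.\<close>

lemma bess_Suc_same:
  "of_nat (2 * Suc m) * poly (bess m (Suc m)) x = bessd (Suc m) x + of_nat (Suc m) * x * bessd m x"
  "of_nat (2 * Suc m) * poly (bess (Suc m) m) x = bessd (Suc m) x - of_nat (Suc m) * x * bessd m x"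
proof -
  have 1: "poly (bess m (Suc m)) x = poly (bess (Suc m) m) x + x * bessd m x"
    using arg_cong[OF bess_Suc_right[of m m], of "\<lambda>p. poly p x"] by (simp add: bessd_def)
  have 2: "bessd (Suc m) x = of_nat (Suc m) * (poly (bess m (Suc m)) x + poly (bess (Suc m) m) x)"
    using arg_cong[OF bess_Suc_Suc[of m m], of "\<lambda>p. poly p x"] by (simp add: bessd_def algebra_simps)
  show "of_nat (2 * Suc m) * poly (bess m (Suc m)) x = bessd (Suc m) x + of_nat (Suc m) * x * bessd m x"
    "of_nat (2 * Suc m) * poly (bess (Suc m) m) x = bessd (Suc m) x - of_nat (Suc m) * x * bessd m x"
    unfolding 2 1 by (simp_all add: algebra_simps)
qed

text \<open>Three-term recurrence of the reverse Bessel polynomials in this normalisation, found by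
  eliminating the off-diagonal polynomials.\<close>

lemma bessd_rec:
  "bessd (Suc (Suc m)) x =
     of_nat (Suc (Suc m)) * (of_nat (4 * Suc m + 2) * bessd (Suc m) x + of_nat (Suc m) * x\<^sup>2 * bessd m x)"
proof -
  define n :: complex where "n = of_nat m"
  have n: "of_nat m = n" "1 + n \<noteq> 0"
    using of_nat_neq_0[of m, where 'a = complex] by (simp_all add: n_def)
  let ?b = "\<lambda>p q. poly (bess p q) x"
  note E = arg_cong[of _ _ "\<lambda>p. poly p x"]
  have 1: "bessd (Suc (Suc m)) x = (n + 2) * (?b (Suc m) (Suc (Suc m)) + ?b (Suc (Suc m)) (Suc m))"
    using E[OF bess_Suc_Suc[of "Suc m" "Suc m"]] n by (simp add: bessd_def algebra_simps)
  have 2: "?b (Suc m) (Suc (Suc m)) = ?b (Suc (Suc m)) (Suc m) + x * bessd (Suc m) x"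
    using E[OF bess_Suc_right[of "Suc m" "Suc m"]] by (simp add: bessd_def)
  have 3: "?b (Suc (Suc m)) (Suc m) = (n + 2) * bessd (Suc m) x + (n + 1) * ?b (Suc (Suc m)) m"
    using E[OF bess_Suc_Suc[of "Suc m" m]] n by (simp add: bessd_def algebra_simps)
  have 4: "bessd (Suc m) x = ?b (Suc (Suc m)) m + x * ?b (Suc m) m"
    using E[OF bess_Suc_right[of "Suc m" m]] by (simp add: bessd_def)
  have 5: "2 * (n + 1) * ?b (Suc m) m = bessd (Suc m) x - (n + 1) * x * bessd m x"
    using bess_Suc_same(2)[of m x] n by (simp add: algebra_simps)
  have "2 * ((n + 1) * ?b (Suc (Suc m)) m) = 2 * (n + 1) * bessd (Suc m) x - x * (bessd (Suc m) x - (n + 1) * x * bessd m x)"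
    unfolding 5[symmetric] using 4 by (simp add: algebra_simps)
  then have "2 * ?b (Suc (Suc m)) (Suc m) = 2 * (n + 2) * bessd (Suc m) x + (2 * (n + 1) * bessd (Suc m) x - x * (bessd (Suc m) x - (n + 1) * x * bessd m x))"
    unfolding 3 by (simp add: algebra_simps)
  then have "2 * ?b (Suc (Suc m)) (Suc m) + x * bessd (Suc m) x = (4 * n + 6) * bessd (Suc m) x + (n + 1) * x\<^sup>2 * bessd m x"
    by (simp add: algebra_simps power2_eq_square)
  moreover have "bessd (Suc (Suc m)) x = (n + 2) * (2 * ?b (Suc (Suc m)) (Suc m) + x * bessd (Suc m) x)"
    unfolding 1 2 by (simp add: algebra_simps)
  ultimately show ?thesis using n by (simp add: algebra_simps)
qed

text \<open>The recurrence turns into \<open>\<rho>' = \<alpha> / x + \<beta> / \<rho>\<close> with \<open>\<alpha>, \<beta> > 0\<close> for the ratios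
  \<open>\<rho> = bessd (m + 1) x / (x * bessd m x)\<close>, and the right half-plane is invariant under this step.\<close>

lemma bessd_ratio_Re_pos:
  assumes "Re x \<ge> 0" "x \<noteq> 0"
  shows "bessd m x \<noteq> 0 \<and> Re (bessd (Suc m) x / (x * bessd m x)) > 0"
proof (induction m)
  have pos: "Re (1 / w) > 0" if "Re w > 0" for w
    using that by (simp add: Re_divide) (metis add_pos_nonneg divide_pos_pos zero_le_power2 zero_less_power)
  have nonneg: "Re (1 / x) \<ge> 0"
    using assms by (simp add: Re_divide)
  {
    case 0
    have "bessd (Suc 0) x / (x * bessd 0 x) = of_real 2 * (1 / x) + 1"
      using assms by (simp add: bessd_0 bessd_1 field_simps)
    then have "Re (bessd (Suc 0) x / (x * bessd 0 x)) = 2 * Re (1 / x) + 1"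
      by (simp only: plus_complex.sel one_complex.sel Re_complex_of_real Im_complex_of_real times_complex.sel)
    with nonneg show ?case
      by (simp add: bessd_0)
  next
    case (Suc m)
    define r where "r = bessd (Suc m) x / (x * bessd m x)"
    have r: "Re r > 0" and B: "bessd m x \<noteq> 0" using Suc by (simp_all add: r_def)
    then have "r \<noteq> 0" by auto
    then have B1: "bessd (Suc m) x \<noteq> 0" by (auto simp: r_def)
    define \<alpha> \<beta> where "\<alpha> = real (Suc (Suc m)) * real (4 * Suc m + 2)" and "\<beta> = real (Suc (Suc m)) * real (Suc m)"
    have "\<alpha> > 0" "\<beta> > 0" by (simp_all only: \<alpha>_def \<beta>_def) simp_all
    have "bessd (Suc (Suc m)) x = of_real \<alpha> * bessd (Suc m) x + of_real \<beta> * x\<^sup>2 * bessd m x"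
      unfolding bessd_rec by (simp only: \<alpha>_def \<beta>_def of_real_mult of_real_of_nat_eq algebra_simps)
    then have "bessd (Suc (Suc m)) x / (x * bessd (Suc m) x) = of_real \<alpha> * (1 / x) + of_real \<beta> * (1 / r)"
      using assms B B1 by (simp add: r_def field_simps power2_eq_square)
    then have "Re (bessd (Suc (Suc m)) x / (x * bessd (Suc m) x)) = \<alpha> * Re (1 / x) + \<beta> * Re (1 / r)"
      by (simp only: plus_complex.sel Re_complex_of_real Im_complex_of_real times_complex.sel)
    then show ?case
      using B1 nonneg pos[OF r] \<open>\<alpha> > 0\<close> \<open>\<beta> > 0\<close> by (simp add: add_nonneg_pos)
  }
qed

text \<open>The recurrence involves only x^2, so it is the same for x and -x. The Casoratian of the
  two solutions starts from 2 x and is multiplied by a nonzero factor at each step.\<close>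

lemma bessd_casoratian:
  assumes "x \<noteq> 0"
  shows "bessd (Suc m) x * bessd m (- x) \<noteq> bessd (Suc m) (- x) * bessd m x"
proof (induction m)
  case 0
  show ?case using assms by (auto simp: bessd_0 bessd_1 complex_eq_iff)
next
  case (Suc m)
  have alg: "a * (b * p + c * y * q) * p' - a * (b * p' + c * y * q') * p = - (a * c * y * (p * q' - p' * q))"
    for a b c y p q p' q' :: complex
    by (simp add: algebra_simps)
  have "bessd (Suc (Suc m)) x * bessd (Suc m) (- x) - bessd (Suc (Suc m)) (- x) * bessd (Suc m) x =
    - (of_nat (Suc (Suc m)) * of_nat (Suc m) * x\<^sup>2 *
        (bessd (Suc m) x * bessd m (- x) - bessd (Suc m) (- x) * bessd m x))"
    unfolding bessd_rec power2_minus by (rule alg)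
  moreover have "\<dots> \<noteq> 0"
    using Suc assms of_nat_neq_0[where 'a = complex]
    by (metis (no_types, lifting) mult_eq_0_iff neg_equal_0_iff_equal power_not_zero right_minus_eq)
  ultimately show ?case by auto
qed

lemma cnj_bessd: "cnj (bessd m x) = bessd m (cnj x)"
  by (simp add: bessd_def bess_def poly_sum poly_monom)

section \<open>Stability of the Pade approximant\<close>

lemma poly_sum_coeffs:
  fixes p :: "'a::comm_ring_1 poly"
  shows "degree p \<le> n \<Longrightarrow> poly p x = (\<Sum>k\<le>n. coeff p k * x ^ k)"
  using arg_cong[OF poly_as_sum_of_monoms'[of p n], of "\<lambda>p. poly p x"] by (simp add: poly_sum poly_monom)

lemma coeff_pade_den:
  "coeff (pade_den s) k = (- 1) ^ k * of_nat (Suc s choose k) * fact (2 * s - k) / fact (2 * s)"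
proof (cases "k \<le> Suc s")
  case True
  then show ?thesis
    by (simp add: pade_den_def coeff_sum if_distrib binomial_fact field_simps del: binomial_Suc_Suc fact_Suc sum.atMost_Suc cong: if_cong)
qed (simp add: pade_den_def coeff_sum binomial_eq_0)

lemma coeff_pade_num:
  "coeff (pade_num s) k = of_nat ((s - 1) choose k) * fact (2 * s - k) / fact (2 * s)"
proof (cases "k \<le> s - 1")
  case True
  then show ?thesis
    by (simp add: pade_num_def coeff_sum if_distrib binomial_fact field_simps del: fact_Suc cong: if_cong)
qed (simp add: pade_num_def coeff_sum binomial_eq_0)

lemma degree_pade_den: "degree (pade_den s) = Suc s"
proof (rule antisym)
  show "degree (pade_den s) \<le> Suc s"
    by (rule degree_le) (simp add: coeff_pade_den binomial_eq_0)
  show "Suc s \<le> degree (pade_den s)"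
    by (rule le_degree) (simp add: coeff_pade_den)
qed

lemma degree_pade_num: "degree (pade_num s) = s - 1"
proof (rule antisym)
  show "degree (pade_num s) \<le> s - 1"
    by (rule degree_le) (simp add: coeff_pade_num binomial_eq_0)
  show "s - 1 \<le> degree (pade_num s)"
    by (rule le_degree) (simp add: coeff_pade_num)
qed

lemma cpoly_pade_den_0: "cpoly (pade_den s) 0 = 1"
  by (simp add: poly_0_coeff_0 coeff_map_poly coeff_pade_den)

lemma cpoly_pade_den:
  "fact (2 * Suc m) * cpoly (pade_den (Suc m)) (- x) = poly (bess m (Suc (Suc m))) x"
proof -
  have "degree (bess m (Suc (Suc m))) \<le> Suc (Suc m)"
    by (rule degree_le) (simp add: coeff_bess binomial_eq_0)
  moreover have "degree (map_poly complex_of_real (pade_den (Suc m))) \<le> Suc (Suc m)"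
    by (simp add: degree_map_poly degree_pade_den)
  moreover have "fact (2 * Suc m) * (coeff (map_poly complex_of_real (pade_den (Suc m))) k * (- x) ^ k) =
      coeff (bess m (Suc (Suc m))) k * x ^ k" for k
    by (cases "even k") (simp_all add: coeff_map_poly coeff_pade_den coeff_bess mult_2 del: binomial_Suc_Suc fact_Suc)
  ultimately show ?thesis
    by (simp only: poly_sum_coeffs sum_distrib_left)
qed

lemma cpoly_pade_num:
  "fact (2 * Suc m) * cpoly (pade_num (Suc m)) x = poly (bess (Suc (Suc m)) m) x"
proof -
  have "degree (bess (Suc (Suc m)) m) \<le> m"
    by (rule degree_le) (simp add: coeff_bess binomial_eq_0)
  moreover have "degree (map_poly complex_of_real (pade_num (Suc m))) \<le> m"
    by (simp add: degree_map_poly degree_pade_num)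
  moreover have "fact (2 * Suc m) * (coeff (map_poly complex_of_real (pade_num (Suc m))) k * x ^ k) =
      coeff (bess (Suc (Suc m)) m) k * x ^ k" for k
    by (simp add: coeff_map_poly coeff_pade_num coeff_bess mult_2 del: binomial_Suc_Suc fact_Suc)
  ultimately show ?thesis
    by (simp only: poly_sum_coeffs sum_distrib_left)
qed

text \<open>The multipliers of \<open>bessd (Suc m)\<close> and \<open>bessd m\<close> are the same
  in both formulas; only the arguments of \<open>bessd\<close> change sign. This reduces common
  zeros to the Casoratian and the imaginary axis to complex conjugation.\<close>

lemma pade_bessd:
  fixes m :: nat and x :: complex
  defines "\<sigma> \<equiv> of_nat (Suc m)"
  shows "2 * \<sigma> * fact (2 * Suc m) * cpoly (pade_den (Suc m)) (- x) =
      (2 * \<sigma> + x) * bessd (Suc m) x + \<sigma> * x\<^sup>2 * bessd m x"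
    and "2 * \<sigma> * fact (2 * Suc m) * cpoly (pade_num (Suc m)) (- x) =
      (2 * \<sigma> + x) * bessd (Suc m) (- x) + \<sigma> * x\<^sup>2 * bessd m (- x)"
proof -
  have "poly (bess m (Suc (Suc m))) x = bessd (Suc m) x + x * poly (bess m (Suc m)) x"
    by (simp add: bess_Suc_right[of m "Suc m"] bessd_def)
  then have "2 * \<sigma> * poly (bess m (Suc (Suc m))) x =
      2 * \<sigma> * bessd (Suc m) x + x * (of_nat (2 * Suc m) * poly (bess m (Suc m)) x)"
    by (simp add: \<sigma>_def algebra_simps)
  also have "\<dots> = (2 * \<sigma> + x) * bessd (Suc m) x + \<sigma> * x\<^sup>2 * bessd m x"
    unfolding bess_Suc_same \<sigma>_def[symmetric] by (simp add: algebra_simps power2_eq_square)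
  finally show "2 * \<sigma> * fact (2 * Suc m) * cpoly (pade_den (Suc m)) (- x) = \<dots>"
    by (simp only: mult.assoc cpoly_pade_den)
  let ?y = "- x"
  have "bessd (Suc m) ?y = poly (bess (Suc (Suc m)) m) ?y + ?y * poly (bess (Suc m) m) ?y"
    using arg_cong[OF bess_Suc_right[of "Suc m" m], of "\<lambda>p. poly p ?y"] by (simp add: bessd_def)
  then have "poly (bess (Suc (Suc m)) m) ?y = bessd (Suc m) ?y + x * poly (bess (Suc m) m) ?y"
    by (simp add: algebra_simps)
  then have "2 * \<sigma> * poly (bess (Suc (Suc m)) m) ?y =
      2 * \<sigma> * bessd (Suc m) ?y + x * (of_nat (2 * Suc m) * poly (bess (Suc m) m) ?y)"
    by (simp add: \<sigma>_def algebra_simps)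
  also have "\<dots> = (2 * \<sigma> + x) * bessd (Suc m) ?y + \<sigma> * x\<^sup>2 * bessd m ?y"
    unfolding bess_Suc_same \<sigma>_def[symmetric] by (simp add: algebra_simps power2_eq_square)
  finally show "2 * \<sigma> * fact (2 * Suc m) * cpoly (pade_num (Suc m)) (- x) = \<dots>"
    by (simp only: mult.assoc cpoly_pade_num)
qed

text \<open>With z = -x and r the ratio from \<open>bessd_ratio_Re_pos\<close>, a zero would force w
  r = -1 for some w with positive real part, but -1/w lies in the left half-plane and r does
  not.\<close>

lemma pade_den_nonzero:
  assumes "Re z \<le> 0" "s \<ge> 1"
  shows "cpoly (pade_den s) z \<noteq> 0"
proof (cases "z = 0")
  case False
  obtain m where s: "s = Suc m" using assms by (cases s) auto
  define x where "x = - z"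
  have x: "x \<noteq> 0" "Re x \<ge> 0" using assms False by (simp_all add: x_def)
  define r where "r = bessd (Suc m) x / (x * bessd m x)"
  have r: "bessd m x \<noteq> 0" "Re r > 0" using bessd_ratio_Re_pos[of x m] x by (simp_all add: r_def)
  define \<sigma> where "\<sigma> = real (Suc m)"
  have \<sigma>: "\<sigma> > 0" by (simp add: \<sigma>_def)
  \<comment> \<open>This is (2 \<sigma> + x) / (\<sigma> x), split so that its real part can be read
    off.\<close>
  define w where "w = of_real 2 * (1 / x) + of_real (1 / \<sigma>)"
  have "Re w = 2 * Re (1 / x) + 1 / \<sigma>"
    unfolding w_def by (simp only: plus_complex.sel Re_complex_of_real Im_complex_of_real times_complex.sel)
  then have w: "Re w > 0" using \<sigma> x by (simp add: Re_divide add_nonneg_pos)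
  show ?thesis
  proof
    assume "cpoly (pade_den s) z = 0"
    then have "(2 * of_real \<sigma> + x) * bessd (Suc m) x + of_real \<sigma> * x\<^sup>2 * bessd m x = 0"
      using pade_bessd(1)[of m x] by (simp add: s x_def \<sigma>_def)
    moreover have "bessd (Suc m) x = r * x * bessd m x"
      using r x by (simp add: r_def)
    ultimately have "((2 * of_real \<sigma> + x) * r + of_real \<sigma> * x) * (x * bessd m x) = 0"
      by (simp add: algebra_simps power2_eq_square)
    then have "(2 * of_real \<sigma> + x) * r + of_real \<sigma> * x = 0"
      using r x by simp
    moreover have "of_real \<sigma> * x * w = 2 * of_real \<sigma> + x"
      using \<sigma> x by (simp add: w_def field_simps)
    ultimately have "of_real \<sigma> * x * (w * r + 1) = 0"
      by (simp add: algebra_simps)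
    then have "w * r = - 1"
      using \<sigma> x by (simp add: add_eq_0_iff2)
    moreover have "w \<noteq> 0" using w by auto
    ultimately have "r = - 1 / w" by (metis nonzero_eq_divide_eq mult.commute)
    then have "Re r = - (Re w / (cmod w)\<^sup>2)"
      by (simp add: Re_divide cmod_power2)
    also have "\<dots> \<le> 0" using w by simp
    finally show False using r by simp
  qed
qed (simp add: cpoly_pade_den_0)

text \<open>At a common zero both expressions in \<open>pade_bessd\<close> vanish with the same
  multipliers, the second of which is nonzero, so the Casoratian would vanish.\<close>

lemma pade_no_common_zero:
  assumes "s \<ge> 1" "cpoly (pade_den s) z = 0" 
  shows "cpoly (pade_num s) z \<noteq> 0"
proof
  assume *: "cpoly (pade_num s) z = 0"
  obtain m where s: "s = Suc m" using assms by (cases s) auto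
  define x where "x = - z"
  have x: "x \<noteq> 0" using assms cpoly_pade_den_0[of s] by (auto simp: x_def)
  define \<sigma> :: complex where "\<sigma> = of_nat (Suc m)"
  have \<sigma>: "\<sigma> \<noteq> 0" unfolding \<sigma>_def by (rule of_nat_neq_0)
  have alg: "b * (p * q' - p' * q) = 0" if "a * p + b * q = 0" "a * p' + b * q' = 0" for a b p q p' q' :: complex
  proof -
    have "b * (p * q' - p' * q) = p * (a * p' + b * q') - p' * (a * p + b * q)"
      by (simp add: algebra_simps)
    then show ?thesis using that by simp
  qed
  have "(2 * \<sigma> + x) * bessd (Suc m) x + \<sigma> * x\<^sup>2 * bessd m x = 0"
    "(2 * \<sigma> + x) * bessd (Suc m) (- x) + \<sigma> * x\<^sup>2 * bessd m (- x) = 0"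
    unfolding \<sigma>_def pade_bessd[symmetric] using assms * by (simp_all add: s x_def)
  then have "\<sigma> * x\<^sup>2 * (bessd (Suc m) x * bessd m (- x) - bessd (Suc m) (- x) * bessd m x) = 0"
    by (rule alg)
  then show False using \<sigma> x bessd_casoratian[OF x, of m] by simp
qed

text \<open>Here the values of \<open>bessd\<close> at -x are the conjugates of those at x. The
  difference of the squared moduli is then a positive multiple of the numerator of the real part of
  the Bessel ratio.\<close>

lemma pade_imaginary_axis:
  assumes "Re z = 0" "s \<ge> 1"
  shows "cmod (cpoly (pade_num s) z) \<le> cmod (cpoly (pade_den s) z)"
proof (cases "z = 0")
  case True
  then show ?thesis by (simp add: cpoly_pade_den_0) (simp add: poly_0_coeff_0 coeff_map_poly coeff_pade_num)
next
  case False
  obtain m where s: "s = Suc m" using assms by (cases s) auto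
  define y where "y = - Im z"
  have y: "y \<noteq> 0" and z: "z = - (\<i> * of_real y)"
    using assms False by (auto simp: y_def complex_eq_iff)
  define \<sigma> where "\<sigma> = real (Suc m)"
  have \<sigma>: "\<sigma> > 0" by (simp add: \<sigma>_def)
  define B where "B = bessd (Suc m) (\<i> * of_real y)"
  define C where "C = bessd m (\<i> * of_real y)"
  have cnj: "bessd k (- (\<i> * of_real y)) = cnj (bessd k (\<i> * of_real y))" for k
    by (simp add: cnj_bessd)
  have C0: "C \<noteq> 0" and r: "Re (B / (\<i> * of_real y * C)) > 0"
    using bessd_ratio_Re_pos[of "\<i> * of_real y" m] y by (simp_all add: B_def C_def)
  have "Re (B / (\<i> * of_real y * C)) = y * (Im B * Re C - Re B * Im C) / (cmod (\<i> * of_real y * C))\<^sup>2"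
    by (simp add: Re_divide cmod_power2 algebra_simps power2_eq_square[of "y * _"])
  then have "y * (Im B * Re C - Re B * Im C) > 0"
    using r by (simp add: zero_less_divide_iff)
  then have pos: "4 * \<sigma> * y\<^sup>2 * (y * (Im B * Re C - Re B * Im C)) \<ge> 0"
    using \<sigma> by simp
  define K where "K = 2 * \<sigma> * fact (2 * Suc m)"
  have K: "K > 0" using \<sigma> by (simp add: K_def)
  define p where "p = (2 * of_real \<sigma> + \<i> * of_real y) * cnj B + of_real \<sigma> * (\<i> * of_real y)\<^sup>2 * cnj C"
  define q where "q = (2 * of_real \<sigma> + \<i> * of_real y) * B + of_real \<sigma> * (\<i> * of_real y)\<^sup>2 * C"
  have KC: "complex_of_real K = 2 * of_nat (Suc m) * fact (2 * Suc m)"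
    by (simp add: K_def \<sigma>_def)
  have "p = of_real K * cpoly (pade_num s) z" "q = of_real K * cpoly (pade_den s) z"
    unfolding KC s z pade_bessd p_def q_def B_def C_def \<sigma>_def cnj by simp_all
  \<comment> \<open>The terms with the squared moduli of \<open>B\<close> and \<open>C\<close>
    cancel; only the cross terms remain.\<close>
  moreover have "(cmod q)\<^sup>2 - (cmod p)\<^sup>2 = 4 * \<sigma> * y\<^sup>2 * (y * (Im B * Re C - Re B * Im C))"
    unfolding p_def q_def cmod_power2 by (simp add: power2_eq_square) (simp add: algebra_simps)
  then have "(cmod p)\<^sup>2 \<le> (cmod q)\<^sup>2"
    using pos by linarith
  then have "cmod p \<le> cmod q"
    by (rule power2_le_imp_le) simp
  ultimately show ?thesis using K by (simp add: norm_mult)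
qed

lemma pade_tendsto_0:
  "((\<lambda>z. cpoly (pade_num s) z / cpoly (pade_den s) z) \<longlongrightarrow> 0) at_infinity"
  by (rule poly_divide_tendsto_0_at_infinity) (simp add: degree_map_poly degree_pade_num degree_pade_den)

text \<open>Maximum principle on a large half-disc, bounded by the imaginary axis and an arc on
  which the decay at infinity applies.\<close>

lemma pade_left_half_plane:
  assumes "Re z \<le> 0" "s \<ge> 1"
  shows "cmod (cpoly (pade_num s) z / cpoly (pade_den s) z) \<le> 1"
proof -
  let ?R = "\<lambda>z. cpoly (pade_num s) z / cpoly (pade_den s) z"
  have "\<forall>\<^sub>F z in at_infinity. cmod (?R z) < 1"
    using order_tendstoD(2)[OF tendsto_norm[OF pade_tendsto_0[of s]], of 1] by simp
  then obtain r where r: "\<And>z. cmod z \<ge> r \<Longrightarrow> cmod (?R z) < 1"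
    by (auto simp: eventually_at_infinity)
  \<comment> \<open>Radius at least \<open>r\<close> gives modulus below 1 on the arc; the maximum
    with \<open>cmod z\<close> puts \<open>z\<close> into the half-disc.\<close>
  define S where "S = {w. Re w \<le> 0} \<inter> cball 0 (max r (cmod z))"
  have clS: "closed S" unfolding S_def by (intro closed_Int closed_halfspace_Re_le closed_cball)
  have hol: "?R holomorphic_on S"
    using pade_den_nonzero \<open>s \<ge> 1\<close> by (intro holomorphic_intros) (simp_all add: S_def)
  show ?thesis
  proof (rule maximum_modulus_frontier[of ?R S])
    show "?R holomorphic_on interior S"
      using hol interior_subset by (rule holomorphic_on_subset)
    show "continuous_on (closure S) ?R"
      using hol clS by (simp add: holomorphic_on_imp_continuous_on)
    show "bounded S" by (simp add: S_def bounded_Int)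
    show "z \<in> S" using assms by (simp add: S_def)
    fix w assume w: "w \<in> frontier S"
    then have wS: "w \<in> S" using clS by (simp add: frontier_def)
    have "{w. Re w < 0} \<inter> ball 0 (max r (cmod z)) \<subseteq> interior S"
      by (intro interior_maximal open_Int open_halfspace_Re_lt open_ball) (auto simp: S_def)
    then have "w \<notin> {w. Re w < 0} \<inter> ball 0 (max r (cmod z))"
      using w by (auto simp: frontier_def)
    then consider "Re w = 0" | "cmod w \<ge> r" using wS by (auto simp: S_def)
    then show "cmod (?R w) \<le> 1"
    proof cases
      case 1
      then show ?thesis
        using pade_imaginary_axis[OF 1 \<open>s \<ge> 1\<close>] pade_den_nonzero[of w s] assms by (simp add: norm_divide)
    next
      case 2
      then show ?thesis using r less_imp_le by blast
    qed
  qed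
qed

section \<open>Order conditions and uniqueness of the approximant\<close>

text \<open>Inclusion-exclusion: the right-hand side counts the m-subsets of an n-set that avoid a
  given a-subset. The induction on a uses Pascal's rule on both sides.\<close>

lemma alternating_choose_sum:
  assumes "a \<le> n" "m \<le> n"
  shows "(\<Sum>k\<le>m. (- 1) ^ k * real (a choose k) * real ((n - k) choose (m - k))) = real ((n - a) choose m)"
  using assms
proof (induction a arbitrary: n m)
  case 0
  have "(\<Sum>k\<le>m. (- 1) ^ k * real (0 choose k) * real ((n - k) choose (m - k))) =
      (\<Sum>k\<in>{0}. (- 1) ^ k * real (0 choose k) * real ((n - k) choose (m - k)))"
    by (rule sum.mono_neutral_right) (auto simp: binomial_eq_0)
  then show ?case by simp
next
  case (Suc a)
  show ?case
  proof (cases m)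
    case 0
    then show ?thesis by simp
  next
    case m: (Suc m')
    obtain n' where n: "n = Suc n'" using Suc.prems by (cases n) auto
    have "(\<Sum>k\<le>m. (- 1) ^ k * real (Suc a choose k) * real ((n - k) choose (m - k))) =
      (\<Sum>k\<le>m. (- 1) ^ k * real (a choose k) * real ((n - k) choose (m - k))) -
      (\<Sum>k\<le>m'. (- 1) ^ k * real (a choose k) * real ((n' - k) choose (m' - k)))"
      unfolding m sum.atMost_Suc_shift
      by (simp add: n algebra_simps sum.distrib sum_negf sum_subtractf)
    also have "\<dots> = real ((n - a) choose m) - real ((n' - a) choose m')"
      using Suc.prems by (subst (1 2) Suc.IH) (simp_all add: n m)
    also have "\<dots> = real ((n - Suc a) choose m)"
      using Suc.prems by (simp add: n m Suc_diff_le)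
    finally show ?thesis .
  qed
qed

lemma pade_den_times_exp_nth:
  "fps_nth (fps_of_poly (pade_den s) * fps_exp x) n = (\<Sum>k\<le>n. coeff (pade_den s) k * x ^ (n - k) / fact (n - k))"
  by (simp add: fps_mult_nth atLeast0AtMost)

lemma coeff_stage_poly:
  "coeff (stage_poly s x) n =
     (if n \<le> 2 * s then fps_nth (fps_of_poly (pade_den s) * fps_exp x) n else 0)"
  by (simp add: stage_poly_def coeff_truncate_fps)

lemma stage_poly_0: "s \<ge> 1 \<Longrightarrow> stage_poly s 0 = pade_den s"
  by (rule poly_eqI) (simp add: coeff_stage_poly coeff_pade_den binomial_eq_0)

lemma coeff_0_stage_poly: "coeff (stage_poly s x) 0 = 1"
  by (simp add: coeff_stage_poly pade_den_times_exp_nth coeff_pade_den)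

text \<open>The coefficient of z^n is a multiple of the alternating sum above, hence of
  \<open>(s - 1) choose n\<close>. Its vanishing for s \<le> n \<le> 2 s is the order condition of
  the approximant.\<close>

lemma stage_poly_1:
  assumes "s \<ge> 1"
  shows "stage_poly s 1 = pade_num s"
proof (rule poly_eqI)
  fix n
  show "coeff (stage_poly s 1) n = coeff (pade_num s) n"
  proof (cases "n \<le> 2 * s")
    case True
    have "coeff (pade_den s) k * 1 ^ (n - k) / fact (n - k) =
        fact (2 * s - n) / fact (2 * s) * ((- 1) ^ k * real (Suc s choose k) * real ((2 * s - k) choose (n - k)))"
      if "k \<le> n" for k
    proof -
      have "2 * s - k - (n - k) = 2 * s - n" "n - k \<le> 2 * s - k"
        using that True by simp_all
      then show ?thesis
        using binomial_fact[of "n - k" "2 * s - k", where 'a = real]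
        by (simp add: coeff_pade_den field_simps del: binomial_Suc_Suc)
    qed
    then have "coeff (stage_poly s 1) n = fact (2 * s - n) / fact (2 * s) *
        (\<Sum>k\<le>n. (- 1) ^ k * real (Suc s choose k) * real ((2 * s - k) choose (n - k)))"
      using True unfolding coeff_stage_poly pade_den_times_exp_nth sum_distrib_left by simp
    also have "\<dots> = fact (2 * s - n) / fact (2 * s) * real ((s - 1) choose n)"
      using True assms by (subst alternating_choose_sum) simp_all
    finally show ?thesis by (simp add: coeff_pade_num)
  next
    case False
    then show ?thesis by (simp add: coeff_stage_poly coeff_pade_num binomial_eq_0)
  qed
qed

text \<open>The factorials \<open>fact (2 * s - k)\<close> cancel and all terms up to k = s + 1 are
  present, which leaves a binomial expansion. Its sign does not change on [0, 1], and independence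
  rests on this.\<close>

lemma coeff_stage_poly_top:
  assumes "s \<ge> 1"
  shows "coeff (stage_poly s x) (2 * s) = x ^ (s - 1) * (x - 1) ^ Suc s / fact (2 * s)"
proof -
  have "coeff (stage_poly s x) (2 * s) = (\<Sum>k\<le>2 * s. (- 1) ^ k * real (Suc s choose k) * x ^ (2 * s - k) / fact (2 * s))"
    by (simp add: coeff_stage_poly pade_den_times_exp_nth coeff_pade_den mult.assoc del: binomial_Suc_Suc)
  also have "\<dots> = (\<Sum>k\<le>Suc s. (- 1) ^ k * real (Suc s choose k) * x ^ (2 * s - k) / fact (2 * s))"
    using assms by (intro sum.mono_neutral_right) (auto simp: binomial_eq_0)
  also have "\<dots> = (\<Sum>k\<le>Suc s. x ^ (s - 1) / fact (2 * s) * (real (Suc s choose k) * (- 1) ^ k * x ^ (Suc s - k)))"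
  proof (rule sum.cong)
    fix k assume "k \<in> {..Suc s}"
    then have "2 * s - k = (s - 1) + (Suc s - k)" using assms by simp
    then show "(- 1) ^ k * real (Suc s choose k) * x ^ (2 * s - k) / fact (2 * s) =
        x ^ (s - 1) / fact (2 * s) * (real (Suc s choose k) * (- 1) ^ k * x ^ (Suc s - k))"
      by (simp add: power_add)
  qed simp
  also have "\<dots> = x ^ (s - 1) * (- 1 + x) ^ Suc s / fact (2 * s)"
    unfolding sum_distrib_left[symmetric] by (subst binomial_ring) simp
  finally show ?thesis by simp
qed

section \<open>Order of vanishing at 0 and uniqueness of the approximant\<close>

lemma bigo_power_if_fps_nth_eq_0:
  fixes F :: "'a::{banach, real_normed_field} fps"
  assumes f: "f has_fps_expansion F" and F: "\<And>k. k < n \<Longrightarrow> fps_nth F k = 0"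
  shows "f \<in> O[at 0](\<lambda>z. z ^ n)"
proof -
  define G where "G = fps_shift n F"
  have G: "fps_conv_radius G > 0"
    using f by (simp add: G_def has_fps_expansion_def)
  have "F = fps_X ^ n * G"
    by (rule fps_ext) (auto simp: G_def F fps_X_power_mult_nth)
  moreover have "(\<lambda>z. z ^ n * eval_fps G z) has_fps_expansion (fps_X ^ n * G)"
    using G by (intro fps_expansion_intros eval_fps_has_fps_expansion)
  ultimately have "\<forall>\<^sub>F z in nhds 0. z ^ n * eval_fps G z = f z"
    using f by (auto simp: has_fps_expansion_def elim: eventually_elim2)
  then have ev: "\<forall>\<^sub>F z in at 0. z ^ n * eval_fps G z = f z"
    by (simp add: eventually_nhds_conv_at)
  have "eval_fps G \<midarrow>0\<rightarrow> eval_fps G 0"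
    using has_fps_expansion_imp_continuous[OF eval_fps_has_fps_expansion[OF G], of UNIV]
    by (simp add: isCont_def)
  then have "eval_fps G \<in> O[at 0](\<lambda>_. 1)"
    by (intro bigoI_tendsto) simp_all
  then have "(\<lambda>z. z ^ n * eval_fps G z) \<in> O[at 0](\<lambda>z. z ^ n * 1)"
    by (intro landau_o.big.mult) simp_all
  then show ?thesis
    using ev by (subst landau_o.big.in_cong[of f "\<lambda>z. z ^ n * eval_fps G z"]) (auto elim: eventually_mono)
qed

text \<open>Splitting off the exact power of z leaves a factor that is nonzero at 0, while the bound
  forces it to tend to 0.\<close>

lemma poly_eq_0_if_bigo:
  fixes p :: "'a::real_normed_field poly"
  assumes O: "poly p \<in> O[at 0](\<lambda>z. z ^ n)" and deg: "degree p < n"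
  shows "p = 0"
proof (rule ccontr)
  assume p: "p \<noteq> 0"
  define k where "k = order 0 p"
  obtain q where q: "p = [:- 0, 1:] ^ k * q" "\<not> [:- 0, 1:] dvd q"
    using order_decomp[OF p, of 0] by (auto simp: k_def)
  have k: "k < n" using order_degree[OF p, of 0] deg by (simp add: k_def)
  obtain c where "\<forall>\<^sub>F z in at 0. norm (poly p z) \<le> c * norm (z ^ n)"
    using O by (rule landau_o.bigE)
  moreover have "\<forall>\<^sub>F z :: 'a in at 0. z \<noteq> 0"
    by (simp add: eventually_at_filter)
  ultimately have "\<forall>\<^sub>F z in at 0. norm (poly q z) \<le> c * norm z ^ (n - k)"
  proof eventually_elim
    case (elim z)
    have "norm z ^ n = norm z ^ k * norm z ^ (n - k)"
      using k by (simp flip: power_add)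
    then have "norm z ^ k * norm (poly q z) \<le> norm z ^ k * (c * norm z ^ (n - k))"
      using elim by (simp add: q norm_mult norm_power algebra_simps)
    then show ?case using elim by simp
  qed
  moreover have "((\<lambda>z. norm (poly q z)) \<longlongrightarrow> norm (poly q 0)) (at 0)"
    by (intro tendsto_norm) (metis isCont_def poly_isCont)
  moreover have "((\<lambda>z :: 'a. c * norm z ^ (n - k)) \<longlongrightarrow> c * norm (0 :: 'a) ^ (n - k)) (at 0)"
    by (intro tendsto_intros)
  ultimately have "norm (poly q 0) \<le> c * norm (0 :: 'a) ^ (n - k)"
    by (intro tendsto_le[rotated 1]) auto
  then have "poly q 0 = 0" using k by (simp add: power_0_left)
  then show False using q(2) by (simp add: dvd_iff_poly_eq_0)
qed

text \<open>Combining the two error terms eliminates the exponential and leaves a polynomial of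
  degree at most p + q that is O(z^(p+q+1)).\<close>

lemma is_pade_exp_cross:
  assumes 1: "is_pade_exp p q P1 Q1" and 2: "is_pade_exp p q P2 Q2"
  shows "P1 * Q2 = P2 * Q1"
proof -
  have bounded: "poly R \<in> O[at 0](\<lambda>_. 1)" for R :: "complex poly"
    by (rule bigoI_tendsto[where c = "poly R 0"]) (use poly_isCont[where p = R and x = 0] in \<open>simp_all add: isCont_def\<close>)
  let ?E1 = "\<lambda>z. poly Q1 z * exp z - poly P1 z" and ?E2 = "\<lambda>z. poly Q2 z * exp z - poly P2 z"
  have "?E1 \<in> O[at 0](\<lambda>z. z ^ (p + q + 1))" "?E2 \<in> O[at 0](\<lambda>z. z ^ (p + q + 1))"
    using 1 2 by (simp_all only: is_pade_exp_def)
  then have "(\<lambda>z. poly Q1 z * ?E2 z - poly Q2 z * ?E1 z) \<in> O[at 0](\<lambda>z. 1 * z ^ (p + q + 1))"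
    by (rule_tac sum_in_bigo(2)[OF landau_o.big.mult[OF bounded] landau_o.big.mult[OF bounded]])
  moreover have "(\<lambda>z. poly Q1 z * ?E2 z - poly Q2 z * ?E1 z) = poly (P1 * Q2 - P2 * Q1)"
    by (simp add: fun_eq_iff algebra_simps)
  moreover have "degree (P1 * Q2 - P2 * Q1) \<le> p + q"
    using 1 2 degree_mult_le[of P1 Q2] degree_mult_le[of P2 Q1]
    by (intro degree_diff_le) (simp_all add: is_pade_exp_def)
  ultimately have "P1 * Q2 - P2 * Q1 = 0"
    using poly_eq_0_if_bigo[of "P1 * Q2 - P2 * Q1" "p + q + 1"] by simp
  then show ?thesis by simp
qed

text \<open>Every root of q must come from r, so the linear factors of q over the complex numbers
  can be cancelled one at a time.\<close>

lemma dvd_cancel_no_common_zero: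
  fixes p q r :: "complex poly"
  assumes "\<And>z. poly q z = 0 \<Longrightarrow> poly p z \<noteq> 0" "q dvd p * r" "q \<noteq> 0"
  shows "q dvd r"
  using assms
proof (induction "degree q" arbitrary: q r)
  case 0
  then have "is_unit q" by (simp add: is_unit_iff_degree)
  then show ?case by (rule unit_imp_dvd)
next
  case (Suc n)
  have "\<not> constant (poly q)" using Suc.hyps(2) by (simp add: constant_degree)
  then obtain z where z: "poly q z = 0"
    using Fundamental_Theorem_Algebra.fundamental_theorem_of_algebra[of q] by blast
  then obtain q' where q': "q = [:- z, 1:] * q'" by (auto simp: poly_eq_0_iff_dvd elim: dvdE)
  have "q' \<noteq> 0" using Suc.prems(3) q' by auto
  then have deg: "n = degree q'"
    using Suc.hyps(2) degree_mult_eq[of "[:- z, 1:]" q'] by (simp add: q' del: mult_pCons_left)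
  obtain t where t: "p * r = q * t" using Suc.prems(2) by (elim dvdE)
  then have "poly p z * poly r z = 0" using z by (metis mult_zero_left poly_mult)
  then have "poly r z = 0" using Suc.prems(1)[OF z] by simp
  then obtain r' where r': "r = [:- z, 1:] * r'" by (auto simp: poly_eq_0_iff_dvd elim: dvdE)
  have "[:- z, 1:] * (p * r') = [:- z, 1:] * (q' * t)"
    using t unfolding q' r' by (simp only: mult_ac)
  then have "p * r' = q' * t"
    by (simp only: mult_cancel_left pCons_eq_0_iff one_neq_zero simp_thms)
  then have dvd: "q' dvd p * r'" by (rule dvdI)
  have "poly p x \<noteq> 0" if "poly q' x = 0" for x
    using Suc.prems(1)[of x] that unfolding q' by (simp del: mult_pCons_left)
  then have "q' dvd r'"
    by (rule Suc.hyps(1)[OF deg _ dvd \<open>q' \<noteq> 0\<close>])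
  then show ?case unfolding q' r' by (rule mult_dvd_mono[OF dvd_refl])
qed

lemma pade_den_dvd_cancel:
  assumes "s \<ge> 1" "map_poly of_real (pade_den s) dvd map_poly of_real (pade_num s) * r"
  shows "map_poly complex_of_real (pade_den s) dvd r"
proof (rule dvd_cancel_no_common_zero[OF _ assms(2)])
  show "map_poly complex_of_real (pade_den s) \<noteq> 0"
    using cpoly_pade_den_0[of s] by auto
qed (use pade_no_common_zero[OF assms(1)] in blast)

lemma is_pade_exp_pade:
  assumes "s \<ge> 1"
  shows "is_pade_exp (s - 1) (s + 1) (map_poly of_real (pade_num s)) (map_poly of_real (pade_den s))"
proof -
  let ?P = "map_poly complex_of_real (pade_num s)" and ?Q = "map_poly complex_of_real (pade_den s)"
  define F where "F = fps_of_poly ?Q * fps_exp 1 - fps_of_poly ?P"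
  have "fps_nth F n = 0" if "n < s - 1 + (s + 1) + 1" for n
  proof -
    have n: "n \<le> 2 * s" using that assms by simp
    have "fps_nth (fps_of_poly ?Q * fps_exp 1) n = of_real (fps_nth (fps_of_poly (pade_den s) * fps_exp 1) n)"
      by (simp add: fps_mult_nth coeff_map_poly)
    also have "\<dots> = of_real (coeff (stage_poly s 1) n)"
      using n by (simp add: coeff_stage_poly)
    finally show ?thesis
      by (simp add: F_def stage_poly_1[OF assms] coeff_map_poly)
  qed
  moreover have "(\<lambda>z. poly R z) has_fps_expansion fps_of_poly R" for R :: "complex poly"
    by (simp add: has_fps_expansion_def)
  then have "(\<lambda>z. poly ?Q z * exp z - poly ?P z) has_fps_expansion F"
    unfolding F_def by (intro fps_expansion_intros)
  ultimately have "(\<lambda>z. poly ?Q z * exp z - poly ?P z) \<in> O[at 0](\<lambda>z. z ^ (s - 1 + (s + 1) + 1))"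
    by (intro bigo_power_if_fps_nth_eq_0)
  then show ?thesis
    by (simp add: is_pade_exp_def degree_map_poly degree_pade_num degree_pade_den cpoly_pade_den_0)
qed

text \<open>The definite description needs uniqueness. By the cross relation and the absence of
  common zeros a competing denominator is \<open>?Q * g\<close>; its degree makes g constant and the
  value at 0 makes it 1.\<close>

lemma pade_exp_eq:
  assumes "s \<ge> 1"
  shows "pade_exp (s - 1) (s + 1) z = cpoly (pade_num s) z / cpoly (pade_den s) z"
proof -
  let ?P = "map_poly complex_of_real (pade_num s)" and ?Q = "map_poly complex_of_real (pade_den s)"
  have "(THE (P, Q). is_pade_exp (s - 1) (s + 1) P Q) = (?P, ?Q)"
  proof (rule the_equality)
    fix PQ assume *: "case PQ of (P, Q) \<Rightarrow> is_pade_exp (s - 1) (s + 1) P Q"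
    obtain P Q where PQ: "PQ = (P, Q)" by force
    have pade: "is_pade_exp (s - 1) (s + 1) P Q" using * PQ by simp
    then have cross: "?P * Q = P * ?Q"
      using is_pade_exp_cross[OF is_pade_exp_pade[OF assms]] by simp
    then have "?Q dvd ?P * Q" by simp
    then have "?Q dvd Q" by (rule pade_den_dvd_cancel[OF assms])
    then obtain g where g: "Q = ?Q * g" by (elim dvdE)
    have Q: "degree Q \<le> Suc s" "poly Q 0 = 1" using pade by (simp_all add: is_pade_exp_def)
    then have "g \<noteq> 0" using g by auto
    moreover have deg: "degree ?Q = Suc s" by (simp add: degree_map_poly degree_pade_den)
    then have "?Q \<noteq> 0" by auto
    ultimately have "degree g = 0"
      using Q(1) deg by (simp add: g degree_mult_eq)
    moreover have "poly g 0 = 1"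
      using Q(2) by (simp add: g cpoly_pade_den_0)
    ultimately have "g = 1"
      by (metis degree_eq_zeroE one_pCons poly_pCons mult_zero_left add.right_neutral)
    then have "Q = ?Q" by (simp add: g)
    then show "PQ = (?P, ?Q)" using cross \<open>?Q \<noteq> 0\<close> by (simp add: PQ)
  qed (use is_pade_exp_pade[OF assms] in simp)
  then show ?thesis by (simp add: pade_exp_def)
qed

section \<open>Independence of the stage polynomials\<close>

text \<open>Linear extension from monomials. For n = 0 the exponent \<open>n - 1\<close> is 0, but
  the factor \<open>real n\<close> removes that term.\<close>

lemma hermite_functional:
  fixes \<alpha> \<beta> c :: "nat \<Rightarrow> real"
  assumes mom: "\<And>n. n \<le> N \<Longrightarrow> (\<Sum>j\<le>s. \<alpha> j * c j ^ n + \<beta> j * (real n * c j ^ (n - 1))) = 0"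
    and deg: "degree p \<le> N"
  shows "(\<Sum>j\<le>s. \<alpha> j * poly p (c j) + \<beta> j * poly (pderiv p) (c j)) = 0"
proof -
  have p: "p = (\<Sum>n\<le>N. monom (coeff p n) n)"
    using poly_as_sum_of_monoms'[OF deg] by simp
  have "poly p x = (\<Sum>n\<le>N. coeff p n * x ^ n)"
    "poly (pderiv p) x = (\<Sum>n\<le>N. coeff p n * (real n * x ^ (n - 1)))" for x
    by (subst p, simp add: higher_pderiv_sum[of 1, simplified] poly_sum poly_monom pderiv_monom mult_ac)+
  then have "(\<Sum>j\<le>s. \<alpha> j * poly p (c j) + \<beta> j * poly (pderiv p) (c j)) =
      (\<Sum>j\<le>s. \<Sum>n\<le>N. coeff p n * (\<alpha> j * c j ^ n + \<beta> j * (real n * c j ^ (n - 1))))"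
    by (simp add: sum_distrib_left sum.distrib algebra_simps)
  also have "\<dots> = (\<Sum>n\<le>N. coeff p n * (\<Sum>j\<le>s. \<alpha> j * c j ^ n + \<beta> j * (real n * c j ^ (n - 1))))"
    by (subst sum.swap) (simp add: sum_distrib_left)
  finally show ?thesis using mom by simp
qed

definition node_poly :: "(nat \<Rightarrow> real) \<Rightarrow> nat set \<Rightarrow> real poly" where
  "node_poly c S = (\<Prod>k\<in>S. [:- c k, 1:])"

lemma poly_node_poly: "finite S \<Longrightarrow> poly (node_poly c S) x = (\<Prod>k\<in>S. x - c k)"
  by (simp add: node_poly_def poly_prod)

lemma degree_node_poly: "degree (node_poly c S) = card S"
proof (cases "finite S")
  case True
  then show ?thesis
    unfolding node_poly_def by (subst degree_prod_eq_sum_degree) simp_all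
qed (simp add: node_poly_def)

lemma node_poly_nonzero:
  assumes "inj_on c (insert i S)" "finite S" "i \<notin> S"
  shows "poly (node_poly c S) (c i) \<noteq> 0"
  using assms by (auto simp: poly_node_poly inj_on_def)

text \<open>Tested with \<open>(x - c\<^sub>i) (x - c\<^sub>j) \<Prod>(x - c\<^sub>k)\<^sup>2\<close>, the product over \<open>k \<noteq> i, j\<close>, whose degree is \<open>2 s\<close>.\<close>

lemma hermite_functional_derivative_weights:
  fixes \<alpha> \<beta> c :: "nat \<Rightarrow> real"
  assumes mom: "\<And>n. n \<le> 2 * s \<Longrightarrow> (\<Sum>j\<le>s. \<alpha> j * c j ^ n + \<beta> j * (real n * c j ^ (n - 1))) = 0"
    and inj: "inj_on c {..s}" and ij: "i \<le> s" "j \<le> s"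
  shows "\<exists>r>0. \<beta> i = r * \<beta> j"
proof (cases "i = j")
  case False
  let ?S = "{..s} - {i, j}"
  let ?W = "(node_poly c ?S)\<^sup>2"
  define p where "p = [:- c i, 1:] * ([:- c j, 1:] * ?W)"
  have "card ?S = s - 1"
    using False ij by (simp add: card_Diff_subset)
  then have "degree ?W \<le> (s - 1) * 2"
    using degree_power_le[of "node_poly c ?S" 2] by (simp add: degree_node_poly)
  then have "degree ([:- c j, 1:] * ?W) \<le> 1 + (s - 1) * 2"
    by (intro order_trans[OF degree_mult_le]) (simp del: mult_pCons_left)
  then have "degree p \<le> 1 + (1 + (s - 1) * 2)"
    unfolding p_def by (intro order_trans[OF degree_mult_le]) (simp del: mult_pCons_left)
  also have "\<dots> = 2 * s" using False ij by simp
  finally have "degree p \<le> 2 * s" .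
  with mom have 0: "(\<Sum>k\<le>s. \<alpha> k * poly p (c k) + \<beta> k * poly (pderiv p) (c k)) = 0"
    by (rule hermite_functional)
  have W0: "poly (node_poly c ?S) (c k) = 0" if "k \<in> ?S" for k
    using that by (auto simp: poly_node_poly)
  define wi wj where "wi = poly ?W (c i)" and "wj = poly ?W (c j)"
  have "poly p (c k) = 0" if "k \<le> s" for k
    using that W0 by (cases "k = i \<or> k = j") (auto simp: p_def)
  moreover have "poly (pderiv p) (c k) = 0" if "k \<le> s" "k \<noteq> i" "k \<noteq> j" for k
    using that W0[of k] unfolding p_def power2_eq_square pderiv_mult by (simp del: mult_pCons_left)
  ultimately have "(\<Sum>k\<in>{i, j}. \<beta> k * poly (pderiv p) (c k)) = 0"
    using ij by (subst 0[symmetric], intro sum.mono_neutral_cong_left) auto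
  \<comment> \<open>At each of the two nodes only the derivative of the linear factor vanishing
    there survives. The opposite signs of the two differences turn the vanishing sum into an
    equality.\<close>
  moreover have "poly (pderiv p) (c i) = (c i - c j) * wi" "poly (pderiv p) (c j) = (c j - c i) * wj"
    unfolding p_def pderiv_mult by (simp_all add: wi_def wj_def pderiv_pCons del: mult_pCons_left)
  ultimately have "(c i - c j) * (\<beta> i * wi - \<beta> j * wj) = 0"
    using False by (simp add: algebra_simps)
  then have "\<beta> i * wi = \<beta> j * wj"
    using False inj ij by (auto simp: inj_on_def)
  moreover have "wi > 0" "wj > 0"
  proof -
    have "poly (node_poly c ?S) (c k) \<noteq> 0" if "k \<in> {i, j}" for k
      using ij that by (intro node_poly_nonzero inj_on_subset[OF inj]) auto
    then show "wi > 0" "wj > 0" by (simp_all add: wi_def wj_def)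
  qed
  ultimately show ?thesis
    by (intro exI[of _ "wj / wi"]) (simp add: field_simps)
qed (auto intro: exI[of _ 1])

text \<open>With the derivative weights gone, the squared product over the other nodes, of degree 2
  s, isolates \<open>\<alpha> i\<close>.\<close>

lemma hermite_functional_value_weight:
  fixes \<alpha> \<beta> c :: "nat \<Rightarrow> real"
  assumes mom: "\<And>n. n \<le> 2 * s \<Longrightarrow> (\<Sum>j\<le>s. \<alpha> j * c j ^ n + \<beta> j * (real n * c j ^ (n - 1))) = 0"
    and inj: "inj_on c {..s}" and \<beta>: "\<And>j. j \<le> s \<Longrightarrow> \<beta> j = 0" and i: "i \<le> s"
  shows "\<alpha> i = 0"
proof -
  let ?S = "{..s} - {i}"
  define p where "p = (node_poly c ?S)\<^sup>2"
  have "degree p \<le> 2 * s"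
    using order_trans[OF degree_power_le[of "node_poly c ?S" 2]] i by (simp add: p_def degree_node_poly)
  with mom have "(\<Sum>k\<le>s. \<alpha> k * poly p (c k) + \<beta> k * poly (pderiv p) (c k)) = 0"
    by (rule hermite_functional)
  moreover have "(\<Sum>k\<le>s. \<alpha> k * poly p (c k) + \<beta> k * poly (pderiv p) (c k)) = (\<Sum>k\<in>{i}. \<alpha> k * poly p (c k))"
    using i by (intro sum.mono_neutral_cong_right) (auto simp: p_def poly_power poly_node_poly \<beta>)
  ultimately have "\<alpha> i * poly p (c i) = 0" by simp
  moreover have "poly (node_poly c ?S) (c i) \<noteq> 0"
    using inj i by (intro node_poly_nonzero) (simp_all add: insert_absorb)
  then have "poly p (c i) \<noteq> 0"
    by (simp add: p_def)
  ultimately show ?thesis by simp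
qed

text \<open>Division by a series with nonzero constant term, order by order: once the lower
  coefficients of F vanish, the convolution reduces to a single term.\<close>

lemma fps_nth_mult_eq_0_cancel:
  fixes F G :: "'a::idom fps"
  assumes "\<And>n. n \<le> N \<Longrightarrow> fps_nth (G * F) n = 0" "fps_nth G 0 \<noteq> 0" "n \<le> N"
  shows "fps_nth F n = 0"
  using assms(3)
proof (induction n rule: less_induct)
  case (less n)
  have "fps_nth (G * F) n = (\<Sum>i\<in>{0}. fps_nth G i * fps_nth F (n - i))"
    unfolding fps_mult_nth using less by (intro sum.mono_neutral_right) auto
  then show ?case using assms(1)[OF less.prems] assms(2) by simp
qed

section \<open>From stage polynomials to functionals on the doubled nodes\<close>

definition stage_comb :: "nat \<Rightarrow> (nat \<Rightarrow> real) \<Rightarrow> (nat \<Rightarrow> real) \<Rightarrow> (nat \<Rightarrow> real) \<Rightarrow> real poly" where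
  "stage_comb s c \<alpha> \<beta> = (\<Sum>j\<le>s. Polynomial.smult (\<alpha> j) (stage_poly s (c j))) +
     [:0, 1:] * (\<Sum>j\<le>s. Polynomial.smult (\<beta> j) (stage_poly s (c j)))"

text \<open>This is what \<open>stage_comb\<close> becomes when the stage polynomials are replaced
  by their full series and Q_s is divided out.\<close>

definition exp_comb :: "nat \<Rightarrow> (nat \<Rightarrow> real) \<Rightarrow> (nat \<Rightarrow> real) \<Rightarrow> (nat \<Rightarrow> real) \<Rightarrow> real fps" where
  "exp_comb s c \<alpha> \<beta> = (\<Sum>j\<le>s. (fps_const (\<alpha> j) + fps_X * fps_const (\<beta> j)) * fps_exp (c j))"

lemma coeff_stage_comb:
  "coeff (stage_comb s c \<alpha> \<beta>) n = (\<Sum>j\<le>s. \<alpha> j * coeff (stage_poly s (c j)) n) +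
     (if n = 0 then 0 else (\<Sum>j\<le>s. \<beta> j * coeff (stage_poly s (c j)) (n - 1)))"
  by (cases n) (simp_all add: stage_comb_def coeff_sum)

lemma stage_comb_diff:
  "stage_comb s c (\<lambda>j. \<alpha> j - \<alpha>' j) (\<lambda>j. \<beta> j - \<beta>' j) = stage_comb s c \<alpha> \<beta> - stage_comb s c \<alpha>' \<beta>'"
  by (rule poly_eqI) (simp add: coeff_stage_comb sum_subtractf left_diff_distrib)

text \<open>Truncation acts only above degree 2 s, so it is invisible here, also in the shifted
  terms, which use index n - 1.\<close>

lemma coeff_stage_comb_low:
  assumes "n \<le> 2 * s"
  shows "coeff (stage_comb s c \<alpha> \<beta>) n = fps_nth (fps_of_poly (pade_den s) * exp_comb s c \<alpha> \<beta>) n"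
proof -
  have "fps_of_poly (pade_den s) * exp_comb s c \<alpha> \<beta> =
      (\<Sum>j\<le>s. fps_const (\<alpha> j) * (fps_of_poly (pade_den s) * fps_exp (c j)) +
        fps_X * (fps_const (\<beta> j) * (fps_of_poly (pade_den s) * fps_exp (c j))))"
    by (simp add: exp_comb_def sum_distrib_left algebra_simps)
  moreover have "n - Suc 0 \<le> 2 * s" using assms by simp
  ultimately show ?thesis
    using assms by (simp add: coeff_stage_comb coeff_stage_poly fps_sum_nth sum.distrib)
qed

text \<open>Links the series to \<open>hermite_functional\<close>: the right-hand side is the
  functional applied to x^n.\<close>

lemma exp_comb_nth:
  "fact n * fps_nth (exp_comb s c \<alpha> \<beta>) n = (\<Sum>j\<le>s. \<alpha> j * c j ^ n + \<beta> j * (real n * c j ^ (n - 1)))"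
proof -
  have "fps_nth (exp_comb s c \<alpha> \<beta>) n =
      (\<Sum>j\<le>s. \<alpha> j * c j ^ n / fact n + (if n = 0 then 0 else \<beta> j * c j ^ (n - 1) / fact (n - 1)))"
    by (simp add: exp_comb_def fps_sum_nth distrib_right mult.assoc cong: if_cong)
  moreover have "fact n * (\<alpha> j * c j ^ n / fact n + (if n = 0 then 0 else \<beta> j * c j ^ (n - 1) / fact (n - 1))) =
      \<alpha> j * c j ^ n + \<beta> j * (real n * c j ^ (n - 1))" for j
    by (cases n) (simp_all add: field_simps del: of_nat_Suc)
  ultimately show ?thesis by (simp only: sum_distrib_left)
qed

text \<open>Uniqueness and existence of the coefficients rest on this, and in its complex form so
  does the determinant formula.\<close>

lemma stage_comb_independent:
  assumes s: "s \<ge> 1" and c: "c 0 = 0" "c s = 1" "strict_mono_on {0..s} c"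
    and 0: "stage_comb s c \<alpha> \<beta> = 0" and i: "i \<le> s"
  shows "\<alpha> i = 0 \<and> \<beta> i = 0"
proof -
  have inj: "inj_on c {..s}"
    using strict_mono_on_imp_inj_on[OF c(3)] by (simp add: atLeast0AtMost)
  have range: "0 \<le> c j \<and> c j \<le> 1" if "j \<le> s" for j
    using that strict_mono_onD[OF c(3), of 0 j] strict_mono_onD[OF c(3), of j s] c
    by (cases "j = 0"; cases "j = s") auto
  have mom: "(\<Sum>j\<le>s. \<alpha> j * c j ^ n + \<beta> j * (real n * c j ^ (n - 1))) = 0" if "n \<le> 2 * s" for n
  proof -
    have "fps_nth (fps_of_poly (pade_den s) * exp_comb s c \<alpha> \<beta>) k = 0" if "k \<le> 2 * s" for k
      using that coeff_stage_comb_low[OF that, of c \<alpha> \<beta>] by (simp add: 0)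
    then have "fps_nth (exp_comb s c \<alpha> \<beta>) n = 0"
      by (rule fps_nth_mult_eq_0_cancel) (use that in \<open>simp_all add: coeff_pade_den\<close>)
    then show ?thesis using exp_comb_nth[of n s c \<alpha> \<beta>] by simp
  qed
  \<comment> \<open>The coefficient of degree \<open>2 s + 1\<close>; all the values \<open>w (c j)\<close> have the same sign.\<close>
  define w where "w j = (c j) ^ (s - 1) * (1 - c j) ^ Suc s" for j
  have "0 = coeff (stage_comb s c \<alpha> \<beta>) (Suc (2 * s))" by (simp add: 0)
  \<comment> \<open>The \<open>\<alpha>\<close> part has no terms beyond degree 2 s, so only the
    shifted \<open>\<beta>\<close> part contributes.\<close>
  also have "\<dots> = (\<Sum>j\<le>s. \<beta> j * (c j ^ (s - 1) * (c j - 1) ^ Suc s / fact (2 * s)))"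
    by (simp add: coeff_stage_comb coeff_stage_poly_top[OF s] del: power_Suc) (simp add: coeff_stage_poly)
  also have "\<dots> = (\<Sum>j\<le>s. \<beta> j * w j) * ((- 1) ^ Suc s / fact (2 * s))"
  proof -
    have "(c j - 1) ^ Suc s = (- 1) ^ Suc s * (1 - c j) ^ Suc s" for j
      by (simp add: power_mult_distrib[symmetric] del: power_Suc)
    then show ?thesis
      unfolding w_def sum_distrib_right by (intro sum.cong) (simp_all del: power_Suc)
  qed
  finally have \<beta>w: "(\<Sum>j\<le>s. \<beta> j * w j) = 0" by simp
  obtain r where r: "\<And>j. j \<le> s \<Longrightarrow> r j > 0 \<and> \<beta> j = r j * \<beta> 0"
    using hermite_functional_derivative_weights[OF mom inj _ le0] by metis
  have "\<beta> j * w j = \<beta> 0 * (r j * w j)" if "j \<le> s" for j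
    using r[OF that] by simp
  then have "\<beta> 0 * (\<Sum>j\<le>s. r j * w j) = 0"
    unfolding sum_distrib_left \<beta>w[symmetric] by (intro sum.cong refl) (simp only: atMost_iff)
  moreover have "(\<Sum>j\<le>s. r j * w j) > 0"
  proof -
    \<comment> \<open>One positive summand is needed. For s = 1 node 0 serves, since the exponent s
      - 1 is 0; for s > 1 the value \<open>c 1\<close> lies strictly between 0 and 1.\<close>
    define k where "k = (if s = 1 then 0 else 1 :: nat)"
    have k: "k \<le> s" using s by (simp add: k_def)
    have "w k > 0"
      using s c strict_mono_onD[OF c(3), of 0 1] strict_mono_onD[OF c(3), of 1 s]
      by (auto simp: k_def w_def)
    moreover have "w j \<ge> 0" if "j \<le> s" for j
      using range[OF that] by (simp add: w_def)
    then have "r j * w j \<ge> 0" if "j \<le> s" for j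
      using r[OF that] that by (simp add: less_imp_le)
    ultimately show ?thesis
      using k r[OF k] by (intro sum_pos2[of _ k]) simp_all
  qed
  ultimately have "\<beta> 0 = 0" by simp
  then have \<beta>: "\<beta> j = 0" if "j \<le> s" for j using r[OF that] by simp
  then show ?thesis
    using hermite_functional_value_weight[OF mom inj] i by blast
qed

text \<open>Both polynomials have constant term 1, so the division by z is exact and can be traded
  for a multiplication.\<close>

lemma method_coeffs_iff:
  "method_coeffs s c a ah \<longleftrightarrow>
    (\<forall>i\<in>{1..s}. stage_poly s (c i) - pade_den s = pCons 0 (stage_comb s c (a i) (ah i)))"
proof -
  have "(p div [:0, 1:] = q) = (p = pCons 0 q)" if "coeff p 0 = 0" for p q :: "real poly"
  proof -
    have "[:0, 1:] dvd p" using that by (simp add: dvd_iff_poly_eq_0 poly_0_coeff_0)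
    then obtain p' where p': "p = [:0, 1:] * p'" by (elim dvdE)
    then have "p div [:0, 1:] = p'"
      by (metis nonzero_mult_div_cancel_left pCons_eq_0_iff one_neq_zero)
    then show ?thesis using p' by simp
  qed
  moreover have "coeff (stage_poly s x - pade_den s) 0 = 0" for x
    by (simp add: coeff_0_stage_poly coeff_pade_den)
  ultimately have *: "((stage_poly s x - pade_den s) div [:0, 1:] = q) = (stage_poly s x - pade_den s = pCons 0 q)" for x q
    by blast
  show ?thesis unfolding method_coeffs_def * stage_comb_def by (rule refl)
qed

lemma method_coeffs_unique:
  assumes s: "s \<ge> 1" and c: "c 0 = 0" "c s = 1" "strict_mono_on {0..s} c"
    and ab: "method_coeffs s c a ah" "method_coeffs s c b bh" and ij: "i \<in> {1..s}" "j \<le> s"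
  shows "b i j = a i j \<and> bh i j = ah i j"
proof -
  have "stage_comb s c (a i) (ah i) = stage_comb s c (b i) (bh i)"
    using ab ij by (metis method_coeffs_iff pCons_eq_iff)
  then have "stage_comb s c (\<lambda>j. b i j - a i j) (\<lambda>j. bh i j - ah i j) = 0"
    by (simp add: stage_comb_diff)
  from stage_comb_independent[OF s c this ij(2)] show ?thesis by simp
qed

text \<open>Dimension count: the square matrix of the 2 s + 2 polynomials in the monomial basis has
  trivial kernel by independence, hence is invertible.\<close>

lemma stage_comb_surj:
  assumes s: "s \<ge> 1" and c: "c 0 = 0" "c s = 1" "strict_mono_on {0..s} c"
    and deg: "degree p \<le> 2 * s + 1"
  shows "\<exists>\<alpha> \<beta>. stage_comb s c \<alpha> \<beta> = p"
proof -
  let ?n = "2 * s + 2"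
  define f where "f k j = (if j \<le> s then coeff (stage_poly s (c j)) k
      else coeff (pCons 0 (stage_poly s (c (j - Suc s)))) k)" for k j
  define M where "M = Matrix.mat ?n ?n (\<lambda>(k, j). f k j)"
  have M: "M \<in> carrier_mat ?n ?n" by (simp add: M_def)
  have Mv: "(M *\<^sub>v x) $ k = coeff (stage_comb s c (\<lambda>j. x $ j) (\<lambda>j. x $ (Suc s + j))) k"
    if x: "x \<in> carrier_vec ?n" and k: "k < ?n" for x k
  proof -
    have "(M *\<^sub>v x) $ k = (\<Sum>j<?n. f k j * x $ j)"
      using x k by (auto simp: M_def scalar_prod_def atLeast0LessThan intro!: sum.cong)
    also have "{..<?n} = {..s} \<union> (\<lambda>j. Suc s + j) ` {..s}"
    proof -
      have "{..<?n} = {..s} \<union> {0 + Suc s..s + Suc s}" by auto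
      also have "{0 + Suc s..s + Suc s} = (\<lambda>j. Suc s + j) ` {0..s}"
        by (rule image_add_atLeastAtMost[symmetric])
      finally show ?thesis by (simp only: atLeast0AtMost)
    qed
    also have "(\<Sum>j\<in>\<dots>. f k j * x $ j) = (\<Sum>j\<le>s. f k j * x $ j) + (\<Sum>j\<le>s. f k (Suc s + j) * x $ (Suc s + j))"
    proof -
      have "(\<Sum>j\<in>(\<lambda>j. Suc s + j) ` {..s}. f k j * x $ j) = (\<Sum>j\<le>s. f k (Suc s + j) * x $ (Suc s + j))"
        by (subst sum.reindex) (auto simp: inj_on_def)
      then show ?thesis
        by (subst sum.union_disjoint) auto
    qed
    also have "\<dots> = coeff (stage_comb s c (\<lambda>j. x $ j) (\<lambda>j. x $ (Suc s + j))) k"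
      by (cases k) (simp_all add: coeff_stage_comb f_def mult_ac)
    finally show ?thesis .
  qed
  have high: "coeff (stage_comb s c \<alpha> \<beta>) k = 0" if "k \<ge> ?n" for k \<alpha> \<beta>
    using that by (cases k) (simp_all add: coeff_stage_comb coeff_stage_poly)
  have "det M \<noteq> 0"
  proof
    assume "det M = 0"
    then obtain x where x: "x \<in> carrier_vec ?n" "x \<noteq> 0\<^sub>v ?n" "M *\<^sub>v x = 0\<^sub>v ?n"
      using det_0_iff_vec_prod_zero[OF M] by auto
    have "stage_comb s c (\<lambda>j. x $ j) (\<lambda>j. x $ (Suc s + j)) = 0"
    proof (rule poly_eqI)
      fix k show "coeff (stage_comb s c (\<lambda>j. x $ j) (\<lambda>j. x $ (Suc s + j))) k = coeff 0 k"
        using Mv[OF x(1), of k] x(3) high[of k] by (cases "k < ?n") auto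
    qed
    note ind = stage_comb_independent[OF s c this]
    have "x $ k = 0" if "k < ?n" for k
      using ind[of k] ind[of "k - Suc s"] that by (cases "k \<le> s") auto
    then show False using x by auto
  qed
  then obtain B where B: "B \<in> carrier_mat ?n ?n" "M * B = 1\<^sub>m ?n"
    using det_non_zero_imp_unit[OF M, of "()"] by (auto simp: Units_def ring_mat_def)
  define x where "x = B *\<^sub>v Matrix.vec ?n (coeff p)"
  have x: "x \<in> carrier_vec ?n" using B by (simp add: x_def)
  have Mx: "M *\<^sub>v x = Matrix.vec ?n (coeff p)"
    using B M by (simp add: x_def flip: assoc_mult_mat_vec[of _ ?n ?n _ ?n])
  have "stage_comb s c (\<lambda>j. x $ j) (\<lambda>j. x $ (Suc s + j)) = p"
  proof (rule poly_eqI)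
    fix k show "coeff (stage_comb s c (\<lambda>j. x $ j) (\<lambda>j. x $ (Suc s + j))) k = coeff p k"
      using Mv[OF x, of k] Mx high[of k] deg by (cases "k < ?n") (auto simp: coeff_eq_0)
  qed
  then show ?thesis by blast
qed

lemma method_coeffs_exist:
  assumes s: "s \<ge> 1" and c: "c 0 = 0" "c s = 1" "strict_mono_on {0..s} c"
  shows "\<exists>a ah. method_coeffs s c a ah"
proof -
  have "\<exists>\<alpha> \<beta>. stage_poly s (c i) - pade_den s = pCons 0 (stage_comb s c \<alpha> \<beta>)" for i
  proof -
    obtain q where q: "stage_poly s (c i) - pade_den s = pCons 0 q"
      by (cases "stage_poly s (c i) - pade_den s")
         (metis coeff_0_stage_poly coeff_diff coeff_pCons_0 coeff_pade_den[of s 0] mult_1 power_0 binomial_n_0 of_nat_1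
           diff_zero nonzero_eq_divide_eq fact_nonzero diff_self)
    have "degree (stage_poly s (c i) - pade_den s) \<le> 2 * s"
      by (rule degree_le) (use s in \<open>simp add: coeff_stage_poly coeff_pade_den binomial_eq_0\<close>)
    then have "degree q \<le> 2 * s + 1" unfolding q by (auto simp: degree_pCons_eq_if split: if_splits)
    from stage_comb_surj[OF s c this] q show ?thesis by metis
  qed
  then obtain a ah where "\<And>i. stage_poly s (c i) - pade_den s = pCons 0 (stage_comb s c (a i) (ah i))"
    by metis
  then show ?thesis by (auto simp: method_coeffs_iff)
qed

text \<open>After division by Q_s as power series, the defining identity holds up to order 2 s - 1,
  one order being lost to the division by z. Its coefficient of order m - 1 is the moment
  condition.\<close>

lemma method_coeffs_moments:
  assumes M: "method_coeffs s c a ah" and m: "m \<in> {1..2 * s}" and i: "i \<in> {1..s}"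
  shows "(\<Sum>j\<le>s. a i j * c j ^ (m - 1)) + real (m - 1) * (\<Sum>j\<le>s. ah i j * c j ^ (m - 2)) = c i ^ m / real m"
proof -
  \<comment> \<open>The shifted series is (exp(c_i z) - 1) / z, so \<open>F\<close> is the defect of
    the divided identity.\<close>
  define F where "F = exp_comb s c (a i) (ah i) - fps_shift 1 (fps_exp (c i))"
  obtain m' where m': "m = Suc m'" using m by (cases m) auto
  have "fps_nth (fps_of_poly (pade_den s) * F) n = 0" if "n \<le> 2 * s - 1" for n
  proof -
    have n: "Suc n \<le> 2 * s" using that i by auto
    have "fps_exp (c i) = 1 + fps_X * fps_shift 1 (fps_exp (c i))"
      by (rule fps_ext) simp
    then have E: "fps_of_poly (pade_den s) * (fps_exp (c i) - 1) =
        fps_X * (fps_of_poly (pade_den s) * fps_shift 1 (fps_exp (c i)))"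
      by (metis add_diff_cancel_left' mult.left_commute)
    have "fps_nth (fps_of_poly (pade_den s) * fps_shift 1 (fps_exp (c i))) n =
        fps_nth (fps_of_poly (pade_den s) * (fps_exp (c i) - 1)) (Suc n)"
      unfolding E by simp
    also have "\<dots> = coeff (stage_poly s (c i) - pade_den s) (Suc n)"
      using n by (simp add: algebra_simps coeff_stage_poly)
    also have "\<dots> = coeff (stage_comb s c (a i) (ah i)) n"
      using M i by (simp add: method_coeffs_iff)
    finally show ?thesis
      using n by (simp add: F_def coeff_stage_comb_low right_diff_distrib)
  qed
  then have "fps_nth F m' = 0"
    by (rule fps_nth_mult_eq_0_cancel) (use m m' in \<open>auto simp: coeff_pade_den\<close>)
  then have "fact m' * fps_nth (exp_comb s c (a i) (ah i)) m' = fact m' * (c i ^ m / fact m)"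
    by (simp add: F_def m' del: fact_Suc power_Suc)
  also have "\<dots> = c i ^ m / real m"
    by (simp add: m' del: power_Suc)
  finally show ?thesis
    by (simp add: m' exp_comb_nth sum.distrib sum_distrib_left mult_ac numeral_2_eq_2)
qed

section \<open>The determinant of the stage matrix\<close>

interpretation complex_poly_hom: comm_ring_hom "map_poly complex_of_real"
  by unfold_locales (auto intro!: poly_eqI simp: coeff_map_poly coeff_mult)

text \<open>The coefficient of \<Pi>_j, or of Y_j, in stage equation i with all terms on the left;
  column 0 belongs to the anchor.\<close>

definition stage_row :: "(nat \<Rightarrow> nat \<Rightarrow> real) \<Rightarrow> (nat \<Rightarrow> nat \<Rightarrow> real) \<Rightarrow> nat \<Rightarrow> nat \<Rightarrow> real poly" where
  "stage_row a ah i j = [:of_bool (j = i) - of_bool (j = 0), - a i j, - ah i j:]"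

lemma stage_comb_altdef: "stage_comb s c \<alpha> \<beta> = (\<Sum>j\<le>s. [:\<alpha> j, \<beta> j:] * stage_poly s (c j))"
proof (rule poly_eqI)
  fix n
  show "coeff (stage_comb s c \<alpha> \<beta>) n = coeff (\<Sum>j\<le>s. [:\<alpha> j, \<beta> j:] * stage_poly s (c j)) n"
    by (cases n) (simp_all add: coeff_stage_comb coeff_sum sum.distrib)
qed

text \<open>The defining identity of the coefficients multiplied by z, with \<Pi>_0 = Q_s because
  \<open>c 0 = 0\<close>.\<close>

lemma stage_row_relation:
  assumes s: "s \<ge> 1" and c: "c 0 = 0" and M: "method_coeffs s c a ah" and i: "i \<in> {1..s}"
  shows "(\<Sum>j\<le>s. stage_row a ah i j * stage_poly s (c j)) = 0"
proof -
  have "(\<Sum>j\<le>s. stage_row a ah i j * stage_poly s (c j)) =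
      (\<Sum>j\<le>s. of_bool (j = i) * stage_poly s (c j)) - (\<Sum>j\<le>s. of_bool (j = 0) * stage_poly s (c j)) -
      pCons 0 (\<Sum>j\<le>s. [:a i j, ah i j:] * stage_poly s (c j))"
  proof -
    have "stage_row a ah i j = of_bool (j = i) - of_bool (j = 0) - pCons 0 [:a i j, ah i j:]" for j
      by (auto simp: stage_row_def one_pCons)
    moreover have "pCons 0 (sum f A) = (\<Sum>j\<in>A. pCons 0 (f j))" for f :: "nat \<Rightarrow> real poly" and A
      by (rule poly_eqI) (simp add: coeff_sum coeff_pCons split: nat.split)
    ultimately show ?thesis
      by (simp add: left_diff_distrib sum_subtractf del: minus_pCons)
  qed
  also have "(\<Sum>j\<le>s. of_bool (j = i) * stage_poly s (c j)) = stage_poly s (c i)"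
    using i by (simp add: of_bool_def if_distrib[of "\<lambda>x. x * _"] cong: if_cong)
  also have "(\<Sum>j\<le>s. of_bool (j = 0) * stage_poly s (c j)) = stage_poly s (c 0)"
    by (simp add: of_bool_def if_distrib[of "\<lambda>x. x * _"] cong: if_cong)
  finally show ?thesis
    using M i by (simp only: method_coeffs_iff stage_comb_altdef c stage_poly_0[OF s])
qed

lemma cpoly_stage_row_relation:
  assumes "s \<ge> 1" "c 0 = 0" "method_coeffs s c a ah" "i \<in> {1..s}"
  shows "(\<Sum>j\<le>s. map_poly of_real (stage_row a ah i j) * map_poly of_real (stage_poly s (c j))) = (0 :: complex poly)"
  using arg_cong[OF stage_row_relation[OF assms], of "map_poly complex_of_real"]
  by (simp add: complex_poly_hom.hom_sum complex_poly_hom.hom_mult)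

text \<open>The stage polynomials are real, so real and imaginary parts separate. The complex form
  is needed for null vectors at complex points.\<close>

lemma complex_stage_independent:
  fixes \<alpha> \<beta> :: "nat \<Rightarrow> complex"
  assumes s: "s \<ge> 1" and c: "c 0 = 0" "c s = 1" "strict_mono_on {0..s} c"
    and 0: "(\<Sum>j\<le>s. [:\<alpha> j, \<beta> j:] * map_poly of_real (stage_poly s (c j))) = 0" and i: "i \<le> s"
  shows "\<alpha> i = 0 \<and> \<beta> i = 0"
proof -
  have part: "stage_comb s c (\<lambda>j. f (\<alpha> j)) (\<lambda>j. f (\<beta> j)) = 0"
    if f: "f = Re \<or> f = Im" for f
  proof (rule poly_eqI)
    fix n
    have "f (x + y) = f x + f y" "f (x * of_real r) = f x * r" for x y r
      using f by auto
    moreover have "f 0 = 0" using f by auto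
    ultimately have "f (coeff (\<Sum>j\<le>s. [:\<alpha> j, \<beta> j:] * map_poly of_real (stage_poly s (c j))) n) =
        coeff (stage_comb s c (\<lambda>j. f (\<alpha> j)) (\<lambda>j. f (\<beta> j))) n"
      using f by (cases n) (auto simp: coeff_stage_comb coeff_sum coeff_map_poly sum.distrib)
    then show "coeff (stage_comb s c (\<lambda>j. f (\<alpha> j)) (\<lambda>j. f (\<beta> j))) n = coeff 0 n"
      using \<open>f 0 = 0\<close> by (simp only: 0) simp
  qed
  show ?thesis
    using stage_comb_independent[OF s c part i, of Re] stage_comb_independent[OF s c part i, of Im]
    by (simp add: complex_eq_iff)
qed

text \<open>The cofactors of column k do not involve that column, so Laplace expansion along it is
  linear in its entries.\<close>

lemma det_replace_col_smult:
  fixes A :: "'a::comm_ring_1 mat"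
  assumes A: "A \<in> carrier_mat n n" and v: "v \<in> carrier_vec n" and k: "k < n"
  shows "det (replace_col A (x \<cdot>\<^sub>v v) k) = x * det (replace_col A v k)"
proof -
  have B: "replace_col A w k \<in> carrier_mat n n" for w
    using A by (simp add: replace_col_def)
  have "mat_delete (replace_col A (x \<cdot>\<^sub>v v) k) i k = mat_delete (replace_col A v k) i k" if "i < n" for i
    using A k that by (intro eq_matI) (auto simp: mat_delete_def replace_col_def)
  then have "cofactor (replace_col A (x \<cdot>\<^sub>v v) k) i k = cofactor (replace_col A v k) i k" if "i < n" for i
    using that by (simp add: cofactor_def)
  then show ?thesis
    unfolding laplace_expansion_column[OF B k] sum_distrib_left
    using A v k by (intro sum.cong) (auto simp: replace_col_def)
qed

text \<open>The term with \<open>t\<close> is there because at every point one of \<open>Q\<^sub>s\<close> and \<open>Q\<^sub>s + P\<^sub>s\<close> is nonzero, and then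
  the matrix for \<open>t = 0\<close> or \<open>t = 1\<close>, respectively, is nonsingular there.\<close>

definition bordered_mat :: "nat \<Rightarrow> (nat \<Rightarrow> nat \<Rightarrow> real) \<Rightarrow> (nat \<Rightarrow> nat \<Rightarrow> real) \<Rightarrow> complex \<Rightarrow> complex poly mat" where
  "bordered_mat s a ah t = Matrix.mat s s (\<lambda>(i, j). map_poly of_real (stage_row a ah (Suc i) (Suc j)) -
     (if Suc j = s then Polynomial.smult t (map_poly of_real (stage_row a ah (Suc i) 0)) else 0))"

definition row_rhs :: "nat \<Rightarrow> (nat \<Rightarrow> nat \<Rightarrow> real) \<Rightarrow> (nat \<Rightarrow> nat \<Rightarrow> real) \<Rightarrow> complex poly Matrix.vec" where
  "row_rhs s a ah = Matrix.vec s (\<lambda>i. - map_poly of_real (stage_row a ah (Suc i) 0))"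

definition stage_vec :: "nat \<Rightarrow> (nat \<Rightarrow> real) \<Rightarrow> complex poly Matrix.vec" where
  "stage_vec s c = Matrix.vec s (\<lambda>j. map_poly of_real (stage_poly s (c (Suc j))))"

text \<open>By the stage relations, columns 1 to s produce Q_s times the negated anchor column. The
  extra term in the last column meets \<Pi>_s = P_s and adds t P_s times the same vector.\<close>

lemma bordered_mat_mult_stage_vec:
  assumes s: "s \<ge> 1" and c: "c 0 = 0" "c s = 1" and M: "method_coeffs s c a ah"
  shows "bordered_mat s a ah t *\<^sub>v stage_vec s c =
    (map_poly of_real (pade_den s) + Polynomial.smult t (map_poly of_real (pade_num s))) \<cdot>\<^sub>v row_rhs s a ah"
proof (rule eq_vecI)
  let ?r = "\<lambda>i j. map_poly complex_of_real (stage_row a ah i j)"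
  let ?p = "\<lambda>j. map_poly complex_of_real (stage_poly s (c j))"
  fix i assume "i < dim_vec ((map_poly of_real (pade_den s) +
    Polynomial.smult t (map_poly of_real (pade_num s))) \<cdot>\<^sub>v row_rhs s a ah)"
  then have i: "i < s" by (simp add: row_rhs_def)
  have "0 = (\<Sum>j\<le>s. ?r (Suc i) j * ?p j)"
    using cpoly_stage_row_relation[OF s c(1) M, of "Suc i"] i by simp
  also have "\<dots> = ?r (Suc i) 0 * ?p 0 + (\<Sum>j<s. ?r (Suc i) (Suc j) * ?p (Suc j))"
    by (simp add: lessThan_Suc_atMost[symmetric] sum.lessThan_Suc_shift del: sum.lessThan_Suc)
  finally have rel: "(\<Sum>j<s. ?r (Suc i) (Suc j) * ?p (Suc j)) = - (?r (Suc i) 0 * map_poly of_real (pade_den s))"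
    by (simp add: c stage_poly_0[OF s] eq_neg_iff_add_eq_0 add.commute)
  have "(bordered_mat s a ah t *\<^sub>v stage_vec s c) $ i =
      (\<Sum>j<s. ?r (Suc i) (Suc j) * ?p (Suc j) - (if j = s - 1 then Polynomial.smult t (?r (Suc i) 0) * ?p (Suc j) else 0))"
    using i by (auto simp: bordered_mat_def stage_vec_def scalar_prod_def atLeast0LessThan left_diff_distrib intro!: sum.cong)
  also have "\<dots> = - (?r (Suc i) 0 * map_poly of_real (pade_den s)) - Polynomial.smult t (?r (Suc i) 0) * ?p s"
    using s by (simp add: sum_subtractf rel)
  finally show "(bordered_mat s a ah t *\<^sub>v stage_vec s c) $ i = ((map_poly of_real (pade_den s) +
    Polynomial.smult t (map_poly of_real (pade_num s))) \<cdot>\<^sub>v row_rhs s a ah) $ i"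
    using i by (simp add: row_rhs_def c stage_poly_1[OF s] algebra_simps)
qed (simp add: bordered_mat_def row_rhs_def)

text \<open>Cramer's rule for the last component. The parameter t occurs only in the column that is
  replaced, so the replaced determinant is the same for all t.\<close>

lemma det_bordered_mat_cramer:
  assumes s: "s \<ge> 1" and c: "c 0 = 0" "c s = 1" and M: "method_coeffs s c a ah"
  shows "map_poly of_real (pade_num s) * det (bordered_mat s a ah t) =
    (map_poly of_real (pade_den s) + Polynomial.smult t (map_poly of_real (pade_num s))) *
    det (replace_col (bordered_mat s a ah 0) (row_rhs s a ah) (s - 1))"
proof -
  have A: "bordered_mat s a ah t \<in> carrier_mat s s" by (simp add: bordered_mat_def)
  have v: "stage_vec s c \<in> carrier_vec s" "row_rhs s a ah \<in> carrier_vec s"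
    by (simp_all add: stage_vec_def row_rhs_def)
  have k: "s - 1 < s" using s by simp
  have "replace_col (bordered_mat s a ah t) (row_rhs s a ah) (s - 1) =
      replace_col (bordered_mat s a ah 0) (row_rhs s a ah) (s - 1)"
    by (rule eq_matI) (auto simp: replace_col_def bordered_mat_def)
  moreover have "stage_vec s c $ (s - 1) = map_poly of_real (pade_num s)"
    using s by (simp add: stage_vec_def c stage_poly_1)
  ultimately show ?thesis
    using cramer_lemma_mat[OF A v(1) k] det_replace_col_smult[OF A v(2) k]
    by (simp only: bordered_mat_mult_stage_vec[OF s c M])
qed

text \<open>A left null vector at \<open>z\<^sub>0\<close> makes a combination of the stage equations divisible by \<open>z - z\<^sub>0\<close>;
  dividing leaves a relation with coefficients of degree at most 1, which is trivial by independence.\<close>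

lemma det_bordered_mat_nonzero:
  assumes s: "s \<ge> 1" and c: "c 0 = 0" "c s = 1" "strict_mono_on {0..s} c" and M: "method_coeffs s c a ah"
    and U: "cpoly (pade_den s) z + t * cpoly (pade_num s) z \<noteq> 0"
  shows "poly (det (bordered_mat s a ah t)) z \<noteq> 0"
proof
  let ?r = "\<lambda>i j. map_poly complex_of_real (stage_row a ah i j)"
  let ?p = "\<lambda>j. map_poly complex_of_real (stage_poly s (c j))"
  assume "poly (det (bordered_mat s a ah t)) z = 0"
  interpret ev: comm_ring_hom "\<lambda>p. poly p z" by unfold_locales simp_all
  define A where "A = map_mat (\<lambda>p. poly p z) (bordered_mat s a ah t)"
  have A: "A \<in> carrier_mat s s" by (simp add: A_def bordered_mat_def)
  \<comment> \<open>A null vector of the transpose combines the rows, that is, the stage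
    equations.\<close>
  have "det A\<^sup>T = 0"
    using \<open>poly (det _) z = 0\<close> det_transpose[OF A] by (simp add: A_def)
  then obtain v where v: "v \<in> carrier_vec s" "v \<noteq> 0\<^sub>v s" "A\<^sup>T *\<^sub>v v = 0\<^sub>v s"
    using det_0_iff_vec_prod_zero[of "A\<^sup>T" s] A by auto
  define \<rho> where "\<rho> j = (\<Sum>i<s. Polynomial.smult (v $ i) (?r (Suc i) j))" for j
  \<comment> \<open>In the combined equation all coefficients vanish at z except those of the anchor
    and the last stage, and the latter is t times the former.\<close>
  have \<rho>z: "poly (\<rho> (Suc j)) z = (if Suc j = s then t * poly (\<rho> 0) z else 0)" if j: "j < s" for j
  proof -
    have "0 = (A\<^sup>T *\<^sub>v v) $ j" using v j by simp
    also have "\<dots> = (\<Sum>i<s. v $ i * (poly (?r (Suc i) (Suc j)) z - (if Suc j = s then t * poly (?r (Suc i) 0) z else 0)))"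
      using v(1) j A by (auto simp: scalar_prod_def A_def bordered_mat_def atLeast0LessThan intro!: sum.cong)
    finally show ?thesis
      by (simp add: \<rho>_def poly_sum sum_subtractf sum_distrib_left right_diff_distrib mult_ac split: if_splits)
  qed
  have rel: "(\<Sum>j\<le>s. \<rho> j * ?p j) = 0"
  proof -
    have smult_sum: "Polynomial.smult x (sum f B) = (\<Sum>j\<in>B. Polynomial.smult x (f j))"
      for x :: complex and f and B :: "nat set"
      by (rule poly_eqI) (simp add: coeff_sum sum_distrib_left)
    have "(\<Sum>j\<le>s. \<rho> j * ?p j) = (\<Sum>i<s. Polynomial.smult (v $ i) (\<Sum>j\<le>s. ?r (Suc i) j * ?p j))"
      unfolding \<rho>_def sum_distrib_right smult_sum by (subst sum.swap) simp
    then show ?thesis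
      using cpoly_stage_row_relation[OF s c(1) M] by simp
  qed
  \<comment> \<open>At z the relation reduces to \<rho>_0(z) (Q_s(z) + t P_s(z)) = 0, whose second
    factor is nonzero by \<open>U\<close>.\<close>
  have "0 = poly (\<Sum>j\<le>s. \<rho> j * ?p j) z" by (simp add: rel)
  also have "\<dots> = poly (\<rho> 0) z * poly (?p 0) z + (\<Sum>j<s. poly (\<rho> (Suc j)) z * poly (?p (Suc j)) z)"
    by (simp add: poly_sum lessThan_Suc_atMost[symmetric] sum.lessThan_Suc_shift del: sum.lessThan_Suc)
  also have "(\<Sum>j<s. poly (\<rho> (Suc j)) z * poly (?p (Suc j)) z) =
      (\<Sum>j<s. if j = s - 1 then t * poly (\<rho> 0) z * poly (?p (Suc j)) z else 0)"
    by (rule sum.cong) (auto simp: \<rho>z)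
  also have "poly (\<rho> 0) z * poly (?p 0) z + \<dots> = poly (\<rho> 0) z * (cpoly (pade_den s) z + t * cpoly (pade_num s) z)"
    using s by (simp add: c stage_poly_0 stage_poly_1 algebra_simps)
  finally have "poly (\<rho> 0) z = 0" using U by simp
  then have "poly (\<rho> j) z = 0" if "j \<le> s" for j
    using that \<rho>z[of "j - 1"] by (cases j) auto
  then have "[:- z, 1:] dvd \<rho> j" if "j \<le> s" for j
    using that by (simp add: poly_eq_0_iff_dvd)
  then obtain w where w: "\<And>j. j \<le> s \<Longrightarrow> \<rho> j = [:- z, 1:] * w j"
    unfolding dvd_def by metis
  define \<alpha> \<beta> where "\<alpha> j = coeff (w j) 0" and "\<beta> j = coeff (w j) 1" for j
  have wlin: "w j = [:\<alpha> j, \<beta> j:]" if "j \<le> s" for j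
  proof -
    have "degree (\<rho> j) \<le> 2"
      unfolding \<rho>_def by (intro degree_sum_le) (auto intro!: order_trans[OF degree_smult_le] simp: degree_map_poly stage_row_def)
    then have "degree (w j) \<le> 1"
      using w[OF that] degree_mult_eq[of "[:- z, 1:]" "w j"] by (cases "w j = 0") auto
    then show ?thesis
      by (intro poly_eqI) (auto simp: \<alpha>_def \<beta>_def coeff_pCons coeff_eq_0 split: nat.splits)
  qed
  then have \<rho>: "\<rho> j = [:- z, 1:] * [:\<alpha> j, \<beta> j:]" if "j \<le> s" for j
    using that w by metis
  have "[:- z, 1:] * (\<Sum>j\<le>s. [:\<alpha> j, \<beta> j:] * ?p j) = (\<Sum>j\<le>s. \<rho> j * ?p j)"
    unfolding sum_distrib_left
  proof (rule sum.cong[OF refl])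
    fix j assume "j \<in> {..s}"
    then have "\<rho> j * ?p j = ([:- z, 1:] * [:\<alpha> j, \<beta> j:]) * ?p j" by (simp only: \<rho> atMost_iff)
    then show "[:- z, 1:] * ([:\<alpha> j, \<beta> j:] * ?p j) = \<rho> j * ?p j" by (simp only: mult.assoc)
  qed
  then have "[:- z, 1:] * (\<Sum>j\<le>s. [:\<alpha> j, \<beta> j:] * ?p j) = 0"
    by (simp only: rel)
  then have "(\<Sum>j\<le>s. [:\<alpha> j, \<beta> j:] * ?p j) = 0"
    by (simp only: mult_eq_0_iff pCons_eq_0_iff one_neq_zero simp_thms)
  note ind = complex_stage_independent[OF s c this]
  have "v $ k = 0" if k: "k < s" for k
  proof -
    \<comment> \<open>In column k + 1 only the diagonal entry has a constant term, namely 1, so the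
      constant coefficient of \<rho>_(k+1) is v_k.\<close>
    have "\<rho> (Suc k) = 0"
      using ind[of "Suc k"] \<rho>[of "Suc k"] k by simp
    then have "0 = coeff (\<rho> (Suc k)) 0" by simp
    also have "\<dots> = (\<Sum>i<s. if i = k then v $ i else 0)"
      unfolding \<rho>_def coeff_sum by (rule sum.cong) (auto simp: coeff_map_poly stage_row_def)
    also have "\<dots> = v $ k" using k by simp
    finally show ?thesis by simp
  qed
  then show False using v by (metis carrier_vecD eq_vecI index_zero_vec)
qed

lemma stage_mat_eq: "stage_mat s a ah z = map_mat (\<lambda>p. poly p z) (bordered_mat s a ah 0)"
  by (rule eq_matI)
     (auto simp: stage_mat_def coeff_mat_def bordered_mat_def stage_row_def map_poly_pCons algebra_simps power2_eq_square)

lemma stage_rhs_eq: "stage_rhs s a ah z = map_vec (\<lambda>p. poly p z) (row_rhs s a ah)"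
  by (rule eq_vecI)
     (auto simp: stage_rhs_def anchor_vec_def row_rhs_def stage_row_def map_poly_pCons algebra_simps power2_eq_square)

text \<open>Coprimality gives the determinants for t = 0 and t = 1 the form Q_s g and (Q_s + P_s) g
  with a common g. At a zero of g both would vanish, though Q_s or Q_s + P_s is nonzero there. So g
  is constant, and z = 0 gives the value 1.\<close>

lemma det_stage_mat:
  assumes s: "s \<ge> 1" and c: "c 0 = 0" "c s = 1" "strict_mono_on {0..s} c" and M: "method_coeffs s c a ah"
  shows "det (stage_mat s a ah z) = cpoly (pade_den s) z"
proof -
  let ?P = "map_poly complex_of_real (pade_num s)" and ?Q = "map_poly complex_of_real (pade_den s)"
  let ?D = "\<lambda>t. det (bordered_mat s a ah t)"
  let ?N = "det (replace_col (bordered_mat s a ah 0) (row_rhs s a ah) (s - 1))"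
  have ev: "det (stage_mat s a ah x) = poly (?D 0) x" for x
  proof -
    interpret ev: comm_ring_hom "\<lambda>p. poly p x" by unfold_locales simp_all
    show ?thesis by (simp add: stage_mat_eq)
  qed
  have D0: "?P * ?D 0 = ?Q * ?N" and D1: "?P * ?D 1 = (?Q + ?P) * ?N"
    using det_bordered_mat_cramer[OF s c(1,2) M, of 0] det_bordered_mat_cramer[OF s c(1,2) M, of 1] by simp_all
  have P: "?P \<noteq> 0" and Q: "?Q \<noteq> 0"
  proof -
    have "coeff (pade_num s) 0 \<noteq> 0" "coeff (pade_den s) 0 \<noteq> 0"
      by (simp_all add: coeff_pade_num coeff_pade_den)
    then show "?P \<noteq> 0" "?Q \<noteq> 0" by (auto simp: map_poly_eq_0_iff)
  qed
  have "?Q dvd ?P * ?D 0" unfolding D0 by simp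
  then have "?Q dvd ?D 0" by (rule pade_den_dvd_cancel[OF s])
  then obtain g where g: "?D 0 = ?Q * g" by (elim dvdE)
  have "?Q * (?P * g) = ?Q * ?N" using D0 by (simp add: g mult_ac)
  then have "?N = ?P * g" using Q by simp
  then have "?P * ?D 1 = ?P * ((?Q + ?P) * g)" using D1 by (simp add: mult_ac)
  then have g1: "?D 1 = (?Q + ?P) * g" using P by (metis mult_left_cancel)
  have "poly g x \<noteq> 0" for x
  proof
    assume "poly g x = 0"
    then have "cpoly (pade_den s) x = 0" "cpoly (pade_den s) x + cpoly (pade_num s) x = 0"
      using det_bordered_mat_nonzero[OF s c M, of x 0] det_bordered_mat_nonzero[OF s c M, of x 1]
      by (auto simp: g g1)
    then show False using pade_no_common_zero[OF s, of x] by simp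
  qed
  then have "degree g = 0"
    using Fundamental_Theorem_Algebra.fundamental_theorem_of_algebra[of g] by (auto simp: constant_degree)
  then obtain k where k: "g = [:k:]" by (rule degree_eq_zeroE)
  have "stage_mat s a ah 0 = 1\<^sub>m s"
    by (rule eq_matI) (auto simp: stage_mat_def coeff_mat_def)
  then have "poly (?D 0) 0 = 1" using ev[of 0] by simp
  then have "k = 1" by (simp add: g k cpoly_pade_den_0)
  then show ?thesis by (simp add: ev g k)
qed

section \<open>The method on the linear test equation\<close>

lemma cpoly_stage_row:
  "cpoly (stage_row a ah i j) z = of_bool (j = i) - of_bool (j = 0) - z * of_real (a i j) - z\<^sup>2 * of_real (ah i j)"
  by (simp add: stage_row_def map_poly_pCons algebra_simps power2_eq_square)

text \<open>Multiplication by \<open>lam\<close> is its own Frechet derivative at every point, so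
  \<open>lam\<close> and \<open>h\<close> enter only through z and z^2.\<close>

lemma anchored_stages_linear:
  fixes lam :: complex and h :: real
  defines "z \<equiv> lam * of_real h"
  shows "anchored_stages s a ah h (\<lambda>v. lam * v) u Y \<longleftrightarrow>
    Y 0 = u \<and> (\<forall>i\<in>{1..s}. (\<Sum>j\<le>s. cpoly (stage_row a ah i j) z * Y j) = 0)"
proof -
  have sd: "second_deriv (\<lambda>v. lam * v) w = lam * (lam * w)" for w
  proof -
    have "((\<lambda>v. lam * v) has_derivative (\<lambda>v. lam * v)) (at w)"
      by (intro derivative_eq_intros) auto
    then have "frechet_derivative (\<lambda>v. lam * v) (at w) = (\<lambda>v. lam * v)"
      by (rule frechet_derivative_at[symmetric])
    then show ?thesis by (simp add: second_deriv_def)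
  qed
  have residual: "(\<Sum>j\<le>s. cpoly (stage_row a ah i j) z * Y j) =
      Y i - (Y 0 + h *\<^sub>R (\<Sum>j\<le>s. a i j *\<^sub>R (lam * Y j)) + h\<^sup>2 *\<^sub>R (\<Sum>j\<le>s. ah i j *\<^sub>R (lam * (lam * Y j))))"
    if i: "i \<in> {1..s}" for i
  proof -
    have "(\<Sum>j\<le>s. cpoly (stage_row a ah i j) z * Y j) =
        (\<Sum>j\<le>s. of_bool (j = i) * Y j) - (\<Sum>j\<le>s. of_bool (j = 0) * Y j) -
        (\<Sum>j\<le>s. h *\<^sub>R (a i j *\<^sub>R (lam * Y j))) - (\<Sum>j\<le>s. h\<^sup>2 *\<^sub>R (ah i j *\<^sub>R (lam * (lam * Y j))))"
      unfolding sum_subtractf[symmetric]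
      by (intro sum.cong) (simp_all add: cpoly_stage_row z_def scaleR_conv_of_real algebra_simps power2_eq_square)
    moreover have "(\<Sum>j\<le>s. of_bool (j = i) * Y j) = Y i" "(\<Sum>j\<le>s. of_bool (j = 0) * Y j) = Y 0"
      using i by (simp_all add: of_bool_def if_distrib[of "\<lambda>x. x * _"] cong: if_cong)
    ultimately show ?thesis by (simp add: scaleR_sum_right)
  qed
  show ?thesis
    unfolding anchored_stages_def sd by (intro conj_cong ball_cong refl) (simp only: residual right_minus_eq)
qed

lemma stage_mat_carrier: "stage_mat s a ah z \<in> carrier_mat s s"
  by (simp add: stage_mat_eq bordered_mat_def)

text \<open>Bridges the matrix system, indexed from 0, and the residual rows, in which the anchor is
  column 0.\<close>

lemma stage_mat_mult_vec:
  assumes "i < s"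
  shows "(stage_mat s a ah z *\<^sub>v Matrix.vec s (\<lambda>j. Y (Suc j))) $ i - stage_rhs s a ah z $ i * Y 0 =
    (\<Sum>j\<le>s. cpoly (stage_row a ah (Suc i) j) z * Y j)"
proof -
  have "(stage_mat s a ah z *\<^sub>v Matrix.vec s (\<lambda>j. Y (Suc j))) $ i =
      (\<Sum>j<s. cpoly (stage_row a ah (Suc i) (Suc j)) z * Y (Suc j))"
    using assms by (auto simp: stage_mat_eq bordered_mat_def scalar_prod_def atLeast0LessThan intro!: sum.cong)
  moreover have "stage_rhs s a ah z $ i = - cpoly (stage_row a ah (Suc i) 0) z"
    using assms by (simp add: stage_rhs_eq row_rhs_def)
  ultimately show ?thesis
    by (simp add: lessThan_Suc_atMost[symmetric] sum.lessThan_Suc_shift del: sum.lessThan_Suc)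
qed

lemma stage_system_unique:
  assumes det: "det (stage_mat s a ah z) \<noteq> 0" and 0: "X 0 = Y 0"
    and X: "\<And>i. i \<in> {1..s} \<Longrightarrow> (\<Sum>j\<le>s. cpoly (stage_row a ah i j) z * X j) = 0"
    and Y: "\<And>i. i \<in> {1..s} \<Longrightarrow> (\<Sum>j\<le>s. cpoly (stage_row a ah i j) z * Y j) = 0"
    and j: "j \<le> s"
  shows "X j = Y j"
proof (cases j)
  case (Suc k)
  let ?v = "Matrix.vec s (\<lambda>j. X (Suc j) - Y (Suc j))"
  have "stage_mat s a ah z *\<^sub>v ?v = 0\<^sub>v s"
  proof (rule eq_vecI)
    fix i assume "i < dim_vec (0\<^sub>v s :: complex Matrix.vec)"
    then have i: "i < s" by simp
    have "(\<Sum>j\<le>s. cpoly (stage_row a ah (Suc i) j) z * (X j - Y j)) = 0"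
      using X[of "Suc i"] Y[of "Suc i"] i by (simp add: right_diff_distrib sum_subtractf)
    then show "(stage_mat s a ah z *\<^sub>v ?v) $ i = 0\<^sub>v s $ i"
      using stage_mat_mult_vec[OF i, of a ah z "\<lambda>j. X j - Y j"] i 0 by simp
  qed (use stage_mat_carrier[of s a ah z] in simp)
  moreover have "?v \<in> carrier_vec s" by simp
  ultimately have "?v = 0\<^sub>v s"
    using det det_0_iff_vec_prod_zero[OF stage_mat_carrier, of s a ah z] by blast
  then have "?v $ k = 0" using j Suc by simp
  then show ?thesis using j Suc by simp
qed (simp add: 0)

lemma stage_poly_solution:
  assumes s: "s \<ge> 1" and c: "c 0 = 0" and M: "method_coeffs s c a ah" and i: "i \<in> {1..s}"
  shows "(\<Sum>j\<le>s. cpoly (stage_row a ah i j) z * (cpoly (stage_poly s (c j)) z / cpoly (pade_den s) z * u)) = 0"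
proof -
  have "(\<Sum>j\<le>s. cpoly (stage_row a ah i j) z * cpoly (stage_poly s (c j)) z) = 0"
    using arg_cong[OF cpoly_stage_row_relation[OF s c M i], of "\<lambda>p. poly p z"] by (simp add: poly_sum)
  moreover have "(\<Sum>j\<le>s. cpoly (stage_row a ah i j) z * (cpoly (stage_poly s (c j)) z / cpoly (pade_den s) z * u)) =
      (\<Sum>j\<le>s. cpoly (stage_row a ah i j) z * cpoly (stage_poly s (c j)) z) * (u / cpoly (pade_den s) z)"
    unfolding sum_distrib_right by (intro sum.cong) simp_all
  ultimately show ?thesis by simp
qed

lemma stage_mat_inverse:
  assumes "det (stage_mat s a ah z) \<noteq> 0"
  obtains B where "mat_inverse (stage_mat s a ah z) = Some B" "B \<in> carrier_mat s s"
    "stage_mat s a ah z * B = 1\<^sub>m s" "B * stage_mat s a ah z = 1\<^sub>m s"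
proof -
  note S = stage_mat_carrier[of s a ah z]
  have "mat_inverse (stage_mat s a ah z) \<noteq> None"
    using mat_inverse(1)[OF S, of "()"] det_non_zero_imp_unit[OF S assms, of "()"] by blast
  then show ?thesis using mat_inverse(2)[OF S] that by blast
qed

lemma invertible_stage_mat:
  assumes "det (stage_mat s a ah z) \<noteq> 0"
  shows "invertible_mat (stage_mat s a ah z)"
proof -
  obtain B where B: "B \<in> carrier_mat s s" "stage_mat s a ah z * B = 1\<^sub>m s" "B * stage_mat s a ah z = 1\<^sub>m s"
    using assms by (rule stage_mat_inverse)
  then show ?thesis
    using stage_mat_carrier[of s a ah z] by (auto simp: invertible_mat_def inverts_mat_def square_mat.simps)
qed

text \<open>The inverse applied to the right-hand side, extended by the anchor value 1, solves the
  residual equations, and so do the quotients \<Pi>_j / Q_s. Uniqueness identifies the last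
  components.\<close>

lemma stability_fun_eq:
  assumes s: "s \<ge> 1" and c: "c 0 = 0" "c s = 1" "strict_mono_on {0..s} c" and M: "method_coeffs s c a ah"
    and Q: "cpoly (pade_den s) z \<noteq> 0"
  shows "stability_fun s a ah z = cpoly (stage_poly s (c s)) z / cpoly (pade_den s) z"
proof -
  have det: "det (stage_mat s a ah z) \<noteq> 0" using det_stage_mat[OF s c M] Q by simp
  then obtain B where B: "mat_inverse (stage_mat s a ah z) = Some B" "B \<in> carrier_mat s s"
    "stage_mat s a ah z * B = 1\<^sub>m s" by (rule stage_mat_inverse)
  define x where "x = B *\<^sub>v stage_rhs s a ah z"
  have rhs: "stage_rhs s a ah z \<in> carrier_vec s" by (simp add: stage_rhs_eq row_rhs_def)
  have x: "x \<in> carrier_vec s" unfolding x_def by (rule mult_mat_vec_carrier[OF B(2) rhs])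
  have Sx: "stage_mat s a ah z *\<^sub>v x = stage_rhs s a ah z"
    using B rhs by (simp add: x_def flip: assoc_mult_mat_vec[OF stage_mat_carrier B(2) rhs])
  define X where "X j = (if j = 0 then 1 else x $ (j - 1))" for j
  have X: "Matrix.vec s (\<lambda>j. X (Suc j)) = x" using x by (auto simp: X_def)
  have Xsol: "(\<Sum>j\<le>s. cpoly (stage_row a ah i j) z * X j) = 0" if i: "i \<in> {1..s}" for i
  proof -
    have "i - 1 < s" "Suc (i - 1) = i" using i by auto
    then show ?thesis
      using stage_mat_mult_vec[of "i - 1" s a ah z X] by (simp add: X Sx X_def[of 0])
  qed
  have "X s = cpoly (stage_poly s (c s)) z / cpoly (pade_den s) z * 1"
    by (rule stage_system_unique[OF det _ Xsol stage_poly_solution[OF s c(1) M, of _ z 1]])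
       (use Q in \<open>simp_all add: X_def c stage_poly_0[OF s]\<close>)
  moreover have "stability_fun s a ah z = x $ (s - 1)"
    using s x by (simp add: stability_fun_def B(1) x_def)
  ultimately show ?thesis using s by (simp add: X_def)
qed

text \<open>\<open>R\<close> is prescribed only where Q_s is nonzero. That set is open and contains
  the closed left half-plane, so analyticity, bound and limit carry over from P_s / Q_s.\<close>

lemma L_stable_pade:
  assumes s: "s \<ge> 1" and R: "\<And>z. cpoly (pade_den s) z \<noteq> 0 \<Longrightarrow> R z = cpoly (pade_num s) z / cpoly (pade_den s) z"
  shows "L_stable R"
proof -
  let ?F = "\<lambda>z. cpoly (pade_num s) z / cpoly (pade_den s) z"
  define U where "U = {z. cpoly (pade_den s) z \<noteq> 0}"
  have U: "open U" unfolding U_def by (intro open_Collect_neq continuous_intros)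
  have left: "{z. Re z \<le> 0} \<subseteq> U" using pade_den_nonzero[OF _ s] by (auto simp: U_def)
  have "?F holomorphic_on U" by (intro holomorphic_intros) (simp add: U_def)
  then have "R holomorphic_on U" by (rule holomorphic_transform) (simp add: R U_def)
  then have "R analytic_on {z. Re z \<le> 0}"
    using U left by (auto simp: analytic_on_holomorphic)
  moreover have "cmod (R z) \<le> 1" if "Re z \<le> 0" for z
    using R[OF pade_den_nonzero[OF that s]] pade_left_half_plane[OF that s] by simp
  moreover have "(R \<longlongrightarrow> 0) (inf at_infinity (principal {z. Re z \<le> 0}))"
  proof (rule Lim_transform_eventually)
    show "(?F \<longlongrightarrow> 0) (inf at_infinity (principal {z. Re z \<le> 0}))"
      by (rule tendsto_mono[OF _ pade_tendsto_0]) simp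
    show "\<forall>\<^sub>F z in inf at_infinity (principal {z. Re z \<le> 0}). ?F z = R z"
      using R pade_den_nonzero[OF _ s] by (simp add: eventually_inf_principal)
  qed
  ultimately show ?thesis by (simp add: L_stable_def A_stable_def)
qed

text \<open>The quotients \<Pi>_j / Q_s times u are an explicit solution; the nonzero determinant
  makes it the only one.\<close>

lemma anchored_stages_dahlquist:
  fixes lam u :: complex and h :: real
  defines "z \<equiv> lam * of_real h"
  assumes s: "s \<ge> 1" and c: "c 0 = 0" "c s = 1" "strict_mono_on {0..s} c" and M: "method_coeffs s c a ah"
    and Q: "cpoly (pade_den s) z \<noteq> 0"
  shows "\<exists>Y. anchored_stages s a ah h (\<lambda>v. lam * v) u Y"
    and "anchored_stages s a ah h (\<lambda>v. lam * v) u Y \<Longrightarrow> j \<le> s \<Longrightarrow>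
      Y j = cpoly (stage_poly s (c j)) z / cpoly (pade_den s) z * u"
proof -
  let ?G = "\<lambda>j. cpoly (stage_poly s (c j)) z / cpoly (pade_den s) z * u"
  have G0: "?G 0 = u" using Q by (simp add: c stage_poly_0[OF s])
  note G = stage_poly_solution[OF s c(1) M, of _ z u]
  show "\<exists>Y. anchored_stages s a ah h (\<lambda>v. lam * v) u Y"
    unfolding anchored_stages_linear z_def[symmetric] using G0 G by (intro exI[of _ ?G] conjI ballI)
  have det: "det (stage_mat s a ah z) \<noteq> 0" using det_stage_mat[OF s c M] Q by simp
  show "Y j = ?G j" if "anchored_stages s a ah h (\<lambda>v. lam * v) u Y" "j \<le> s"
    by (rule stage_system_unique[OF det _ _ G])
       (use that G0 in \<open>auto simp: anchored_stages_linear simp flip: z_def\<close>)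
qed

theorem theorem5p5:
  fixes s :: nat and c :: "nat \<Rightarrow> real"
  assumes "s \<ge> 1" and "c 0 = 0" and "c s = 1" and "strict_mono_on {0..s} c"
  shows
    "(\<exists>a ah. method_coeffs s c a ah) \<and>
     (\<forall>a ah. method_coeffs s c a ah \<longrightarrow>
       (\<forall>b bh. method_coeffs s c b bh \<longrightarrow>
         (\<forall>i\<in>{1..s}. \<forall>j\<in>{0..s}. b i j = a i j \<and> bh i j = ah i j)) \<and>
       (\<forall>m\<in>{1..2 * s}. \<forall>i\<in>{1..s}.
         (\<Sum>j\<le>s. a i j * c j ^ (m - 1)) + real (m - 1) * (\<Sum>j\<le>s. ah i j * c j ^ (m - 2))
           = c i ^ m / real m) \<and>
       (\<forall>(lam :: complex) (h :: real) (u :: complex).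
         h > 0 \<and> u \<noteq> 0 \<and> cpoly (pade_den s) (lam * of_real h) \<noteq> 0 \<longrightarrow>
           (\<exists>Y. anchored_stages s a ah h (\<lambda>v. lam * v) u Y) \<and>
           (\<forall>Y. anchored_stages s a ah h (\<lambda>v. lam * v) u Y \<longrightarrow>
             (\<forall>j\<in>{1..s}. Y j / u =
               cpoly (stage_poly s (c j)) (lam * of_real h) / cpoly (pade_den s) (lam * of_real h))) \<and>
           (\<forall>u'. anchored_step s a ah h (\<lambda>v. lam * v) u u' \<longleftrightarrow>
             u' = stability_fun s a ah (lam * of_real h) * u)) \<and>
       is_pade_exp (s - 1) (s + 1) (map_poly of_real (pade_num s)) (map_poly of_real (pade_den s)) \<and>
       (\<forall>z. cpoly (pade_den s) z \<noteq> 0 \<longrightarrow>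
         stability_fun s a ah z = cpoly (stage_poly s (c s)) z / cpoly (pade_den s) z \<and>
         stability_fun s a ah z = cpoly (pade_num s) z / cpoly (pade_den s) z \<and>
         stability_fun s a ah z = pade_exp (s - 1) (s + 1) z) \<and>
       (\<forall>z. Determinant.det (stage_mat s a ah z) = cpoly (pade_den s) z) \<and>
       (\<forall>z. cpoly (pade_den s) z \<noteq> 0 \<longrightarrow> invertible_mat (stage_mat s a ah z)) \<and>
       L_stable (stability_fun s a ah) \<and>
       A_stable (stability_fun s a ah))"
proof (intro conjI allI impI ballI)
  show "\<exists>a ah. method_coeffs s c a ah"
    using assms by (rule method_coeffs_exist)
next
  fix a ah assume M: "method_coeffs s c a ah"
  \<comment> \<open>Together these rewrite \<open>stage_poly s (c s)\<close> to
    \<open>pade_num s\<close>.\<close>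
  note [simp] = stage_poly_1[OF assms(1)] assms(3)
  have R: "stability_fun s a ah z = cpoly (stage_poly s (c s)) z / cpoly (pade_den s) z"
    if "cpoly (pade_den s) z \<noteq> 0" for z
    using assms M that by (rule stability_fun_eq)
  {
    fix b bh i j
    assume "method_coeffs s c b bh" "i \<in> {1..s}" "j \<in> {0..s}"
    then show "b i j = a i j" "bh i j = ah i j"
      using method_coeffs_unique[OF assms M] by simp_all
  next
    fix m i assume "m \<in> {1..2 * s}" "i \<in> {1..s}"
    with M show "(\<Sum>j\<le>s. a i j * c j ^ (m - 1)) + real (m - 1) * (\<Sum>j\<le>s. ah i j * c j ^ (m - 2)) = c i ^ m / real m"
      by (rule method_coeffs_moments)
  next
    fix lam u :: complex and h :: real
    assume "h > 0 \<and> u \<noteq> 0 \<and> cpoly (pade_den s) (lam * of_real h) \<noteq> 0"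
    then have u: "u \<noteq> 0" and Q: "cpoly (pade_den s) (lam * of_real h) \<noteq> 0" by simp_all
    note dahlquist = anchored_stages_dahlquist[OF assms M Q, of u]
    show ex: "\<exists>Y. anchored_stages s a ah h (\<lambda>v. lam * v) u Y"
      by (rule dahlquist(1))
    show "Y j / u = cpoly (stage_poly s (c j)) (lam * of_real h) / cpoly (pade_den s) (lam * of_real h)"
      if "anchored_stages s a ah h (\<lambda>v. lam * v) u Y" "j \<in> {1..s}" for Y j
      using dahlquist(2)[OF that(1)] that(2) u by simp
    show "anchored_step s a ah h (\<lambda>v. lam * v) u u' \<longleftrightarrow> u' = stability_fun s a ah (lam * of_real h) * u" for u'
      using ex dahlquist(2)[of _ s] unfolding anchored_step_def R[OF Q] by auto
  next
    show "is_pade_exp (s - 1) (s + 1) (map_poly of_real (pade_num s)) (map_poly of_real (pade_den s))"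
      using assms(1) by (rule is_pade_exp_pade)
  next
    fix z assume Q: "cpoly (pade_den s) z \<noteq> 0"
    show "stability_fun s a ah z = cpoly (stage_poly s (c s)) z / cpoly (pade_den s) z"
      "stability_fun s a ah z = cpoly (pade_num s) z / cpoly (pade_den s) z"
      "stability_fun s a ah z = pade_exp (s - 1) (s + 1) z"
      using R[OF Q] pade_exp_eq[OF assms(1)] by simp_all
    show "invertible_mat (stage_mat s a ah z)"
      using Q det_stage_mat[OF assms M] by (intro invertible_stage_mat) simp
  next
    show "det (stage_mat s a ah z) = cpoly (pade_den s) z" for z
      using assms M by (rule det_stage_mat)
  next
    show L: "L_stable (stability_fun s a ah)"
      using assms(1) R by (intro L_stable_pade) simp_all
    then show "A_stable (stability_fun s a ah)"
      by (simp add: L_stable_def)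
  }
qed

end
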